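(* Let $X,Y$ be complex Banach spaces. The correspondence $f\mapsto f^t$ is an isometric isomorphism from $\mathcal{H}L_0^{\mathcal{W}}(B_X,Y)$, with the Lipschitz norm $L$, onto $\mathcal{L}((Y^*,w^* );(\mathcal{H}L_0(B_X),w))$, the space of all weak*-to-weak continuous linear operators from $Y^*$ into $\mathcal{H}L_0(B_X)$, with the operator norm.
   Context: $B_X$ is the open unit ball of $X$. $\mathcal{H}L_0(B_X,Y)$ is the Banach space of all holomorphic Lipschitz maps $f:B_X\to Y$ with $f(0)=0$, with norm $L(f)=\sup\{\|f(x)-f(y)\|/\|x-y\|: x,y\in B_X,\ x\ne y\}$; $\mathcal{H}L_0(B_X)=\mathcal{H}L_0(B_X,\mathbb{C})$. $\mathcal{H}L_0^{\mathcal{W}}(B_X,Y)$ is the set of weakly compact holomorphic Lipschitz maps, i.e. those $f\in\mathcal{H}L_0(B_X,Y)$ for which $\mathrm{Im}_L(f)=\{(f(x)-f(y))/\|x-y\|:x,y\in B_X,\ x\neq y\}$ is contained in the image of the closed unit ball under some weakly compact operator from a Banach space into $Y$ (equivalently, $\mathrm{Im}_L(f)$ is relatively weakly compact in $Y$). The transpose $f^t:Y^*\to\mathcal{H}L_0(B_X)$ is $f^t(y^* )=y^*\circ f$. The weak topology $w$ on $\mathcal{H}L_0(B_X)$ is that of the Banach space $(\mathcal{H}L_0(B_X),L)$. *)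

theory Defs
  imports "HOL-Analysis.Analysis" "HOL-Library.Function_Algebras"
begin

section \<open>Complex normed and Banach spaces\<close>

class scaleC =
  fixes scaleC :: "complex \<Rightarrow> 'a \<Rightarrow> 'a"  (infixr \<open>*\<^sub>C\<close> 75)

class complex_vector = ab_group_add + scaleC +
  assumes scaleC_add_right: "a *\<^sub>C (x + y) = a *\<^sub>C x + a *\<^sub>C y"
    and scaleC_add_left: "(a + b) *\<^sub>C x = a *\<^sub>C x + b *\<^sub>C x"
    and scaleC_scaleC: "a *\<^sub>C (b *\<^sub>C x) = (a * b) *\<^sub>C x"
    and scaleC_one: "1 *\<^sub>C x = x"

class complex_normed_vector = complex_vector + real_normed_vector +
  assumes scaleR_scaleC: "r *\<^sub>R x = complex_of_real r *\<^sub>C x"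
    and norm_scaleC: "norm (a *\<^sub>C x) = cmod a * norm x"

class complex_banach = complex_normed_vector + banach

global_interpretation complex_vector: vector_space "scaleC :: complex \<Rightarrow> 'a \<Rightarrow> 'a::complex_vector"
  by unfold_locales (simp_all add: scaleC_add_right scaleC_add_left scaleC_scaleC scaleC_one)

instantiation complex :: complex_banach
begin

definition scaleC_complex :: "complex \<Rightarrow> complex \<Rightarrow> complex"
  where "scaleC_complex a z = a * z"

instance
  by standard (simp_all add: scaleC_complex_def algebra_simps scaleR_conv_of_real norm_mult)

end

instantiation "fun" :: (type, complex_vector) complex_vector
begin

definition scaleC_fun :: "complex \<Rightarrow> ('a \<Rightarrow> 'b) \<Rightarrow> 'a \<Rightarrow> 'b"
  where "scaleC_fun a f = (\<lambda>x. a *\<^sub>C f x)"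

instance
  by standard
    (simp_all add: scaleC_fun_def fun_eq_iff scaleC_add_right scaleC_add_left scaleC_scaleC
      scaleC_one)

end

definition clinear_on :: "'a::complex_vector set \<Rightarrow> ('a \<Rightarrow> 'b::complex_vector) \<Rightarrow> bool"
  where "clinear_on V f \<longleftrightarrow>
    (\<forall>x\<in>V. \<forall>y\<in>V. f (x + y) = f x + f y) \<and> (\<forall>a. \<forall>x\<in>V. f (a *\<^sub>C x) = a *\<^sub>C f x)"

text \<open>Norms on a subspace \<open>V\<close> that need not be related to a norm of the ambient type.\<close>

definition complex_norm_on :: "'a::complex_vector set \<Rightarrow> ('a \<Rightarrow> real) \<Rightarrow> bool"
  where "complex_norm_on V n \<longleftrightarrow>
    complex_vector.subspace V \<and>
    (\<forall>x\<in>V. 0 \<le> n x) \<and>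
    (\<forall>x\<in>V. n x = 0 \<longleftrightarrow> x = 0) \<and>
    (\<forall>a. \<forall>x\<in>V. n (a *\<^sub>C x) = cmod a * n x) \<and>
    (\<forall>x\<in>V. \<forall>y\<in>V. n (x + y) \<le> n x + n y)"

definition complex_banach_on :: "'a::complex_vector set \<Rightarrow> ('a \<Rightarrow> real) \<Rightarrow> bool"
  where "complex_banach_on V n \<longleftrightarrow>
    complex_norm_on V n \<and>
    (\<forall>s. (\<forall>k::nat. s k \<in> V) \<longrightarrow> (\<forall>e>0. \<exists>N. \<forall>i\<ge>N. \<forall>j\<ge>N. n (s i - s j) < e) \<longrightarrow>
      (\<exists>l\<in>V. (\<lambda>k. n (s k - l)) \<longlonglongrightarrow> 0))"

definition isometric_isomorphism ::
    "'a::complex_vector set \<Rightarrow> ('a \<Rightarrow> real) \<Rightarrow> 'b::complex_vector set \<Rightarrow> ('b \<Rightarrow> real) \<Rightarrow> ('a \<Rightarrow> 'b) \<Rightarrow> bool"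
  where "isometric_isomorphism V n W m \<Phi> \<longleftrightarrow>
    complex_norm_on V n \<and> complex_norm_on W m \<and>
    clinear_on V \<Phi> \<and> bij_betw \<Phi> V W \<and> (\<forall>x\<in>V. m (\<Phi> x) = n x)"

lemma bounded_linear_scaleC: "bounded_linear (\<lambda>x::'c::complex_normed_vector. a *\<^sub>C x)"
  by (rule bounded_linear_intro[where K = "cmod a"])
    (simp_all add: scaleC_add_right scaleR_scaleC scaleC_scaleC mult.commute norm_scaleC)

lemma onorm_scaleC:
  fixes f :: "'c::complex_normed_vector \<Rightarrow> 'd::complex_normed_vector"
  assumes f: "bounded_linear f"
  shows "onorm (\<lambda>x. a *\<^sub>C f x) = cmod a * onorm f"
proof -
  have le: "onorm (\<lambda>x. b *\<^sub>C g x) \<le> cmod b * onorm g" if "bounded_linear g"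
    for b and g :: "'c \<Rightarrow> 'd"
    by (rule onorm_bound)
      (auto simp: onorm_pos_le that norm_scaleC mult.assoc intro!: mult_left_mono onorm)
  show ?thesis
  proof (cases "a = 0")
    case True
    then show ?thesis by (simp add: onorm_zero)
  next
    case False
    have "onorm f = onorm (\<lambda>x. inverse a *\<^sub>C (a *\<^sub>C f x))"
      using False by (simp add: scaleC_scaleC scaleC_one)
    also have "\<dots> \<le> cmod (inverse a) * onorm (\<lambda>x. a *\<^sub>C f x)"
      by (rule le) (rule bounded_linear_compose[OF bounded_linear_scaleC f])
    finally have "cmod a * onorm f \<le> onorm (\<lambda>x. a *\<^sub>C f x)"
      using False by (simp add: norm_divide field_simps)
    with le[OF f] show ?thesis by (simp add: antisym)
  qed
qed

section \<open>Bounded complex-linear maps and the dual space\<close>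

typedef (overloaded) ('a, 'b) cblinfun =
    "{f :: 'a::complex_normed_vector \<Rightarrow> 'b::complex_normed_vector. bounded_linear f \<and> clinear_on UNIV f}"
  morphisms cblinfun_apply CBlinfun
  by (rule exI[of _ "\<lambda>_. 0"]) (simp add: clinear_on_def)

setup_lifting type_definition_cblinfun

type_synonym 'a cdual = "('a, complex) cblinfun"

instantiation cblinfun :: (complex_normed_vector, complex_normed_vector) complex_normed_vector
begin

lift_definition norm_cblinfun :: "('a, 'b) cblinfun \<Rightarrow> real" is onorm .

lift_definition zero_cblinfun :: "('a, 'b) cblinfun" is "\<lambda>_. 0"
  by (simp add: clinear_on_def)

lift_definition uminus_cblinfun :: "('a, 'b) cblinfun \<Rightarrow> ('a, 'b) cblinfun" is "\<lambda>f x. - f x"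
  by (simp add: clinear_on_def bounded_linear_minus)

lift_definition plus_cblinfun :: "('a, 'b) cblinfun \<Rightarrow> ('a, 'b) cblinfun \<Rightarrow> ('a, 'b) cblinfun"
  is "\<lambda>f g x. f x + g x"
  by (simp add: clinear_on_def bounded_linear_add scaleC_add_right)

lift_definition minus_cblinfun :: "('a, 'b) cblinfun \<Rightarrow> ('a, 'b) cblinfun \<Rightarrow> ('a, 'b) cblinfun"
  is "\<lambda>f g x. f x - g x"
  by (simp add: clinear_on_def bounded_linear_sub complex_vector.scale_right_diff_distrib)

lift_definition scaleC_cblinfun :: "complex \<Rightarrow> ('a, 'b) cblinfun \<Rightarrow> ('a, 'b) cblinfun"
  is "\<lambda>a f x. a *\<^sub>C f x"
  by (simp add: clinear_on_def scaleC_add_right scaleC_scaleC mult.commute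
      bounded_linear_compose[OF bounded_linear_scaleC])

definition scaleR_cblinfun :: "real \<Rightarrow> ('a, 'b) cblinfun \<Rightarrow> ('a, 'b) cblinfun"
  where "scaleR_cblinfun r f = complex_of_real r *\<^sub>C f"

definition dist_cblinfun :: "('a, 'b) cblinfun \<Rightarrow> ('a, 'b) cblinfun \<Rightarrow> real"
  where "dist_cblinfun f g = norm (f - g)"

definition sgn_cblinfun :: "('a, 'b) cblinfun \<Rightarrow> ('a, 'b) cblinfun"
  where "sgn_cblinfun f = scaleR (inverse (norm f)) f"

definition uniformity_cblinfun :: "(('a, 'b) cblinfun \<times> ('a, 'b) cblinfun) filter"
  where "uniformity_cblinfun = (INF e\<in>{0<..}. principal {(x, y). dist x y < e})"

definition open_cblinfun :: "('a, 'b) cblinfun set \<Rightarrow> bool"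
  where "open_cblinfun U = (\<forall>x\<in>U. eventually (\<lambda>(x', y). x' = x \<longrightarrow> y \<in> U) uniformity)"

instance
proof
  fix f g h :: "('a, 'b) cblinfun" and a b :: complex and r s :: real
  show "f + g + h = f + (g + h)" by transfer (simp add: fun_eq_iff add.assoc)
  show "f + g = g + f" by transfer (simp add: fun_eq_iff add.commute)
  show "0 + f = f" by transfer simp
  show "- f + f = 0" by transfer simp
  show "f - g = f + - g" by transfer simp
  show C1: "a *\<^sub>C (f + g) = a *\<^sub>C f + a *\<^sub>C g" for a and f g :: "('a, 'b) cblinfun"
    by transfer (simp add: fun_eq_iff scaleC_add_right)
  show C2: "(a + b) *\<^sub>C f = a *\<^sub>C f + b *\<^sub>C f" for a b and f :: "('a, 'b) cblinfun"
    by transfer (simp add: fun_eq_iff scaleC_add_left)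
  show C3: "a *\<^sub>C (b *\<^sub>C f) = (a * b) *\<^sub>C f" for a b and f :: "('a, 'b) cblinfun"
    by transfer (simp add: fun_eq_iff scaleC_scaleC)
  show C4: "1 *\<^sub>C f = f" for f :: "('a, 'b) cblinfun"
    by transfer (simp add: fun_eq_iff scaleC_one)
  show "r *\<^sub>R (f + g) = r *\<^sub>R f + r *\<^sub>R g" by (simp add: scaleR_cblinfun_def C1)
  show "(r + s) *\<^sub>R f = r *\<^sub>R f + s *\<^sub>R f" by (simp add: scaleR_cblinfun_def C2)
  show "r *\<^sub>R (s *\<^sub>R f) = (r * s) *\<^sub>R f" by (simp add: scaleR_cblinfun_def C3)
  show "1 *\<^sub>R f = f" by (simp add: scaleR_cblinfun_def C4)
  show "r *\<^sub>R f = complex_of_real r *\<^sub>C f" by (rule scaleR_cblinfun_def)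
  show "dist f g = norm (f - g)" by (rule dist_cblinfun_def)
  show "sgn f = scaleR (inverse (norm f)) f" by (rule sgn_cblinfun_def)
  show "(uniformity :: (('a, 'b) cblinfun \<times> ('a, 'b) cblinfun) filter) =
      (INF e\<in>{0<..}. principal {(x, y). dist x y < e})"
    by (rule uniformity_cblinfun_def)
  show "open U = (\<forall>x\<in>U. \<forall>\<^sub>F (x', y) in uniformity. x' = x \<longrightarrow> y \<in> U)"
    for U :: "('a, 'b) cblinfun set"
    by (rule open_cblinfun_def)
  show "norm f = 0 \<longleftrightarrow> f = 0" by transfer (simp add: onorm_eq_0 fun_eq_iff)
  show "norm (f + g) \<le> norm f + norm g" by transfer (simp add: onorm_triangle)
  show nC: "norm (a *\<^sub>C f) = cmod a * norm f" for a and f :: "('a, 'b) cblinfun"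
    by transfer (simp add: onorm_scaleC)
  show "norm (r *\<^sub>R f) = \<bar>r\<bar> * norm f" by (simp add: scaleR_cblinfun_def nC)
qed

end

section \<open>Weak and weak* topologies\<close>

definition weak_topology :: "'a::complex_normed_vector topology"
  where "weak_topology =
    topology_generated_by {cblinfun_apply \<phi> -` U | (\<phi> :: 'a cdual) U. open U}"

definition weak_star_topology :: "'a::complex_normed_vector cdual topology"
  where "weak_star_topology =
    topology_generated_by {(\<lambda>\<phi>. cblinfun_apply \<phi> y) -` U | y U. open U}"

definition relatively_weakly_compact :: "'a::complex_normed_vector set \<Rightarrow> bool"
  where "relatively_weakly_compact K \<longleftrightarrow> compactin weak_topology (weak_topology closure_of K)"

text \<open>The space \<open>\<L>((Y\<^sup>*, w\<^sup>*); (Z, w))\<close>. Norm boundedness of the operators is not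
  part of the definition: it is a consequence of weak*-to-weak continuity, for Banach \<open>Y\<close>.\<close>

definition weak_star_weak_operators ::
    "('y::complex_normed_vector cdual \<Rightarrow> 'z::complex_normed_vector) set"
  where "weak_star_weak_operators =
    {T. clinear_on UNIV T \<and> continuous_map weak_star_topology weak_topology T}"

section \<open>Holomorphic Lipschitz maps\<close>

definition holomorphic_map_on ::
    "('a::complex_normed_vector \<Rightarrow> 'b::complex_normed_vector) \<Rightarrow> 'a set \<Rightarrow> bool"
  where "holomorphic_map_on f U \<longleftrightarrow>
    (\<forall>x\<in>U. \<exists>D :: ('a, 'b) cblinfun. (f has_derivative cblinfun_apply D) (at x))"

lemma holomorphic_map_on_0: "holomorphic_map_on (\<lambda>_. 0) U"
  unfolding holomorphic_map_on_def
  by (intro ballI exI[of _ 0]) (simp add: zero_cblinfun.rep_eq)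

lemma holomorphic_map_on_add:
  assumes "holomorphic_map_on f U" "holomorphic_map_on g U"
  shows "holomorphic_map_on (\<lambda>x. f x + g x) U"
  unfolding holomorphic_map_on_def
proof
  fix x assume "x \<in> U"
  then obtain D E where "(f has_derivative cblinfun_apply D) (at x)"
    "(g has_derivative cblinfun_apply E) (at x)"
    using assms unfolding holomorphic_map_on_def by blast
  then have "((\<lambda>x. f x + g x) has_derivative cblinfun_apply (D + E)) (at x)"
    unfolding plus_cblinfun.rep_eq by (rule has_derivative_add)
  then show "\<exists>D. ((\<lambda>x. f x + g x) has_derivative cblinfun_apply D) (at x)" by blast
qed

lemma holomorphic_map_on_scaleC:
  assumes "holomorphic_map_on f U"
  shows "holomorphic_map_on (\<lambda>x. a *\<^sub>C f x) U"
  unfolding holomorphic_map_on_def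
proof
  fix x assume "x \<in> U"
  then obtain D where "(f has_derivative cblinfun_apply D) (at x)"
    using assms unfolding holomorphic_map_on_def by blast
  then have "((\<lambda>x. a *\<^sub>C f x) has_derivative cblinfun_apply (a *\<^sub>C D)) (at x)"
    unfolding scaleC_cblinfun.rep_eq
    by (rule bounded_linear.has_derivative[OF bounded_linear_scaleC])
  then show "\<exists>D. ((\<lambda>x. a *\<^sub>C f x) has_derivative cblinfun_apply D) (at x)" by blast
qed

lemma lipschitz_on_scaleC:
  fixes f :: "'a::metric_space \<Rightarrow> 'b::complex_normed_vector"
  assumes "K-lipschitz_on U f"
  shows "(cmod a * K)-lipschitz_on U (\<lambda>x. a *\<^sub>C f x)"
  using assms
  by (auto simp: lipschitz_on_def dist_norm norm_scaleC mult.assoc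
      simp flip: complex_vector.scale_right_diff_distrib intro!: mult_left_mono)

text \<open>Maps on the open unit ball are represented by total functions that vanish outside it, so that
  equality of representatives is equality of maps on the ball.\<close>

typedef (overloaded) ('a, 'b) hlip0 =
    "{f :: 'a::complex_normed_vector \<Rightarrow> 'b::complex_normed_vector.
      holomorphic_map_on f (ball 0 1) \<and> (\<exists>K. K-lipschitz_on (ball 0 1) f) \<and> f 0 = 0 \<and>
      (\<forall>x. x \<notin> ball 0 1 \<longrightarrow> f x = 0)}"
  morphisms hlip0_apply Hlip0
  by (rule exI[of _ "\<lambda>_. 0"]) (auto simp: holomorphic_map_on_0 lipschitz_on_def)

setup_lifting type_definition_hlip0

text \<open>The Lipschitz constant on the unit ball. Diagonal pairs contribute \<open>0/0 = 0\<close>; they only fix the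
  convention that the supremum is \<open>0\<close> when the ball is a single point.\<close>

definition lip_norm :: "('a::real_normed_vector \<Rightarrow> 'b::real_normed_vector) \<Rightarrow> real"
  where "lip_norm f = (SUP (x, y)\<in>ball 0 1 \<times> ball 0 1. norm (f x - f y) / norm (x - y))"

lemma lip_norm_bdd:
  assumes "K-lipschitz_on (ball 0 1) f"
  shows "bdd_above ((\<lambda>(x, y). norm (f x - f y) / norm (x - y)) ` (ball 0 1 \<times> ball 0 1))"
proof (rule bdd_aboveI2[of _ _ K], clarify)
  fix x y :: 'a assume "x \<in> ball 0 1" "y \<in> ball 0 1"
  then show "norm (f x - f y) / norm (x - y) \<le> K"
    using lipschitz_on_normD[OF assms, of x y] lipschitz_on_nonneg[OF assms]
    by (cases "x = y") (auto simp: divide_le_eq)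
qed

lemma lip_norm_bound:
  assumes "K-lipschitz_on (ball 0 1) f" "x \<in> ball 0 1" "y \<in> ball 0 1"
  shows "norm (f x - f y) \<le> lip_norm f * norm (x - y)"
proof (cases "x = y")
  case False
  have "norm (f x - f y) / norm (x - y) \<le> lip_norm f"
    unfolding lip_norm_def using cSUP_upper[OF _ lip_norm_bdd[OF assms(1)], of "(x, y)"] assms by auto
  with False show ?thesis by (simp add: divide_le_eq)
qed simp

lemma lip_norm_least:
  fixes f :: "'a::real_normed_vector \<Rightarrow> 'b::real_normed_vector"
  assumes "0 \<le> K"
    and "\<And>x y. x \<in> ball 0 1 \<Longrightarrow> y \<in> ball 0 1 \<Longrightarrow> norm (f x - f y) \<le> K * norm (x - y)"
  shows "lip_norm f \<le> K"
  unfolding lip_norm_def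
proof (rule cSUP_least)
  show "ball (0::'a) 1 \<times> ball (0::'a) 1 \<noteq> {}" by auto
  fix p :: "'a \<times> 'a" assume "p \<in> ball 0 1 \<times> ball 0 1"
  then obtain x y where p: "p = (x, y)" "x \<in> ball 0 1" "y \<in> ball 0 1" by auto
  show "(case p of (x, y) \<Rightarrow> norm (f x - f y) / norm (x - y)) \<le> K"
    using assms(2)[OF p(2,3)] \<open>0 \<le> K\<close> by (cases "x = y") (auto simp: p(1) divide_le_eq)
qed

lemma lip_norm_nonneg:
  fixes f :: "'a::real_normed_vector \<Rightarrow> 'b::real_normed_vector"
  assumes "K-lipschitz_on (ball 0 1) f"
  shows "0 \<le> lip_norm f"
  unfolding lip_norm_def using cSUP_upper[OF _ lip_norm_bdd[OF assms], of "(0, 0)"] by auto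

lemma lip_norm_scaleC:
  fixes f :: "'a::real_normed_vector \<Rightarrow> 'b::complex_normed_vector"
  assumes f: "K-lipschitz_on (ball 0 1) f"
  shows "lip_norm (\<lambda>x. a *\<^sub>C f x) = cmod a * lip_norm f"
proof -
  have le: "lip_norm (\<lambda>x. b *\<^sub>C g x) \<le> cmod b * lip_norm g"
    if g: "M-lipschitz_on (ball 0 1) g" for b M and g :: "'a \<Rightarrow> 'b"
    by (rule lip_norm_least)
      (auto simp: lip_norm_nonneg[OF g] norm_scaleC mult.assoc
        simp flip: complex_vector.scale_right_diff_distrib intro!: mult_left_mono lip_norm_bound[OF g])
  show ?thesis
  proof (cases "a = 0")
    case True
    have "lip_norm (\<lambda>x::'a. 0::'b) = 0"
      using lip_norm_least[of 0 "\<lambda>x::'a. 0::'b"] lip_norm_nonneg[of 0 "\<lambda>x::'a. 0::'b"]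
      by (auto simp: lipschitz_on_def)
    with True show ?thesis by simp
  next
    case False
    have "lip_norm f = lip_norm (\<lambda>x. inverse a *\<^sub>C (a *\<^sub>C f x))"
      using False by (simp add: scaleC_scaleC scaleC_one)
    also have "\<dots> \<le> cmod (inverse a) * lip_norm (\<lambda>x. a *\<^sub>C f x)"
      by (rule le) (rule lipschitz_on_scaleC[OF f])
    finally have "cmod a * lip_norm f \<le> lip_norm (\<lambda>x. a *\<^sub>C f x)"
      using False by (simp add: norm_divide field_simps)
    with le[OF f] show ?thesis by (simp add: antisym)
  qed
qed

instantiation hlip0 :: (complex_normed_vector, complex_normed_vector) complex_normed_vector
begin

lift_definition norm_hlip0 :: "('a, 'b) hlip0 \<Rightarrow> real" is lip_norm .

lift_definition zero_hlip0 :: "('a, 'b) hlip0" is "\<lambda>_. 0"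
  by (auto simp: holomorphic_map_on_0 lipschitz_on_def)

lift_definition plus_hlip0 :: "('a, 'b) hlip0 \<Rightarrow> ('a, 'b) hlip0 \<Rightarrow> ('a, 'b) hlip0"
  is "\<lambda>f g x. f x + g x"
  by (auto simp: holomorphic_map_on_add intro: lipschitz_on_add)

lift_definition scaleC_hlip0 :: "complex \<Rightarrow> ('a, 'b) hlip0 \<Rightarrow> ('a, 'b) hlip0"
  is "\<lambda>a f x. a *\<^sub>C f x"
  by (auto simp: holomorphic_map_on_scaleC intro: lipschitz_on_scaleC)

definition uminus_hlip0 :: "('a, 'b) hlip0 \<Rightarrow> ('a, 'b) hlip0"
  where "uminus_hlip0 f = (- 1) *\<^sub>C f"

definition minus_hlip0 :: "('a, 'b) hlip0 \<Rightarrow> ('a, 'b) hlip0 \<Rightarrow> ('a, 'b) hlip0"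
  where "minus_hlip0 f g = f + - g"

definition scaleR_hlip0 :: "real \<Rightarrow> ('a, 'b) hlip0 \<Rightarrow> ('a, 'b) hlip0"
  where "scaleR_hlip0 r f = complex_of_real r *\<^sub>C f"

definition dist_hlip0 :: "('a, 'b) hlip0 \<Rightarrow> ('a, 'b) hlip0 \<Rightarrow> real"
  where "dist_hlip0 f g = norm (f - g)"

definition sgn_hlip0 :: "('a, 'b) hlip0 \<Rightarrow> ('a, 'b) hlip0"
  where "sgn_hlip0 f = scaleR (inverse (norm f)) f"

definition uniformity_hlip0 :: "(('a, 'b) hlip0 \<times> ('a, 'b) hlip0) filter"
  where "uniformity_hlip0 = (INF e\<in>{0<..}. principal {(x, y). dist x y < e})"

definition open_hlip0 :: "('a, 'b) hlip0 set \<Rightarrow> bool"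
  where "open_hlip0 U = (\<forall>x\<in>U. eventually (\<lambda>(x', y). x' = x \<longrightarrow> y \<in> U) uniformity)"

instance
proof
  fix f g h :: "('a, 'b) hlip0" and a b :: complex and r s :: real
  show "f + g + h = f + (g + h)" by transfer (simp add: fun_eq_iff add.assoc)
  show "f + g = g + f" by transfer (simp add: fun_eq_iff add.commute)
  show "0 + f = f" by transfer simp
  show "- f + f = 0" unfolding uminus_hlip0_def by transfer simp
  show "f - g = f + - g" by (rule minus_hlip0_def)
  show C1: "a *\<^sub>C (f + g) = a *\<^sub>C f + a *\<^sub>C g" for a and f g :: "('a, 'b) hlip0"
    by transfer (simp add: fun_eq_iff scaleC_add_right)
  show C2: "(a + b) *\<^sub>C f = a *\<^sub>C f + b *\<^sub>C f" for a b and f :: "('a, 'b) hlip0"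
    by transfer (simp add: fun_eq_iff scaleC_add_left)
  show C3: "a *\<^sub>C (b *\<^sub>C f) = (a * b) *\<^sub>C f" for a b and f :: "('a, 'b) hlip0"
    by transfer (simp add: fun_eq_iff scaleC_scaleC)
  show C4: "1 *\<^sub>C f = f" for f :: "('a, 'b) hlip0"
    by transfer (simp add: fun_eq_iff scaleC_one)
  show "r *\<^sub>R (f + g) = r *\<^sub>R f + r *\<^sub>R g" by (simp add: scaleR_hlip0_def C1)
  show "(r + s) *\<^sub>R f = r *\<^sub>R f + s *\<^sub>R f" by (simp add: scaleR_hlip0_def C2)
  show "r *\<^sub>R (s *\<^sub>R f) = (r * s) *\<^sub>R f" by (simp add: scaleR_hlip0_def C3)
  show "1 *\<^sub>R f = f" by (simp add: scaleR_hlip0_def C4)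
  show "r *\<^sub>R f = complex_of_real r *\<^sub>C f" by (rule scaleR_hlip0_def)
  show "dist f g = norm (f - g)" by (rule dist_hlip0_def)
  show "sgn f = scaleR (inverse (norm f)) f" by (rule sgn_hlip0_def)
  show "(uniformity :: (('a, 'b) hlip0 \<times> ('a, 'b) hlip0) filter) =
      (INF e\<in>{0<..}. principal {(x, y). dist x y < e})"
    by (rule uniformity_hlip0_def)
  show "open U = (\<forall>x\<in>U. \<forall>\<^sub>F (x', y) in uniformity. x' = x \<longrightarrow> y \<in> U)"
    for U :: "('a, 'b) hlip0 set"
    by (rule open_hlip0_def)
  show "norm f = 0 \<longleftrightarrow> f = 0"
  proof transfer
    fix f :: "'a \<Rightarrow> 'b"
    assume "holomorphic_map_on f (ball 0 1) \<and> (\<exists>K. K-lipschitz_on (ball 0 1) f) \<and> f 0 = 0 \<and>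
      (\<forall>x. x \<notin> ball 0 1 \<longrightarrow> f x = 0)"
    then obtain K where K: "K-lipschitz_on (ball 0 1) f" and f0: "f 0 = 0"
      and out: "\<And>x. x \<notin> ball 0 1 \<Longrightarrow> f x = 0" by blast
    show "lip_norm f = 0 \<longleftrightarrow> f = (\<lambda>_. 0)"
    proof
      assume L: "lip_norm f = 0"
      have "f x = 0" for x
        using lip_norm_bound[OF K, of x 0] L f0 out[of x] by (cases "x \<in> ball 0 1") auto
      then show "f = (\<lambda>_. 0)" by auto
    next
      assume "f = (\<lambda>_. 0)"
      then show "lip_norm f = 0"
        using lip_norm_least[of 0 f] lip_norm_nonneg[OF K] by auto
    qed
  qed
  show "norm (f + g) \<le> norm f + norm g"
  proof transfer
    fix f g :: "'a \<Rightarrow> 'b"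
    assume "holomorphic_map_on f (ball 0 1) \<and> (\<exists>K. K-lipschitz_on (ball 0 1) f) \<and> f 0 = 0 \<and>
        (\<forall>x. x \<notin> ball 0 1 \<longrightarrow> f x = 0)"
      and "holomorphic_map_on g (ball 0 1) \<and> (\<exists>K. K-lipschitz_on (ball 0 1) g) \<and> g 0 = 0 \<and>
        (\<forall>x. x \<notin> ball 0 1 \<longrightarrow> g x = 0)"
    then obtain K L where K: "K-lipschitz_on (ball 0 1) f" and L: "L-lipschitz_on (ball 0 1) g"
      by blast
    show "lip_norm (\<lambda>x. f x + g x) \<le> lip_norm f + lip_norm g"
    proof (rule lip_norm_least)
      show "0 \<le> lip_norm f + lip_norm g"
        using lip_norm_nonneg[OF K] lip_norm_nonneg[OF L] by simp
      fix x y :: 'a assume xy: "x \<in> ball 0 1" "y \<in> ball 0 1"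
      have "norm (f x + g x - (f y + g y)) \<le> norm (f x - f y) + norm (g x - g y)"
        by (rule norm_diff_triangle_ineq)
      also have "\<dots> \<le> (lip_norm f + lip_norm g) * norm (x - y)"
        using lip_norm_bound[OF K xy] lip_norm_bound[OF L xy] by (simp add: distrib_right)
      finally show "norm (f x + g x - (f y + g y)) \<le> (lip_norm f + lip_norm g) * norm (x - y)" .
    qed
  qed
  show nC: "norm (a *\<^sub>C f) = cmod a * norm f" for a and f :: "('a, 'b) hlip0"
    by transfer (auto simp: lip_norm_scaleC)
  show "norm (r *\<^sub>R f) = \<bar>r\<bar> * norm f" by (simp add: scaleR_hlip0_def nC)
qed

end

section \<open>Weakly compact holomorphic Lipschitz maps\<close>

definition lip_image :: "('a::complex_normed_vector, 'b::complex_normed_vector) hlip0 \<Rightarrow> 'b set"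
  where "lip_image f =
    {(hlip0_apply f x - hlip0_apply f y) /\<^sub>R norm (x - y) | x y.
      x \<in> ball 0 1 \<and> y \<in> ball 0 1 \<and> x \<noteq> y}"

text \<open>A weakly compact operator \<open>S\<close> from the Banach space \<open>(E, n)\<close>; only its values on \<open>E\<close> matter.\<close>

definition weakly_compact_operator_on ::
    "'e::complex_vector set \<Rightarrow> ('e \<Rightarrow> real) \<Rightarrow> ('e \<Rightarrow> 'y::complex_normed_vector) \<Rightarrow> bool"
  where "weakly_compact_operator_on E n S \<longleftrightarrow>
    clinear_on E S \<and> (\<exists>C. \<forall>v\<in>E. norm (S v) \<le> C * n v) \<and>
    relatively_weakly_compact (S ` {v \<in> E. n v \<le> 1})"

text \<open>\<open>K\<close> is contained in the image of the closed unit ball under some weakly compact operator from a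
  Banach space into \<open>Y\<close>. HOL cannot quantify over the type carrying the Banach space \<open>E\<close>; here \<open>E\<close>
  ranges over the Banach spaces whose underlying vector space is a subspace of that of \<open>Y\<close>, with an
  arbitrary complete norm. The lemma \<open>W_bounded_setI\<close> below shows that this loses no generality: a
  Banach space on a vector space of any other type can be replaced by its quotient by the kernel of
  the operator.\<close>

definition W_bounded_set :: "'y::complex_normed_vector set \<Rightarrow> bool"
  where "W_bounded_set K \<longleftrightarrow>
    (\<exists>(E :: 'y set) n (S :: 'y \<Rightarrow> 'y).
      complex_banach_on E n \<and> weakly_compact_operator_on E n S \<and> K \<subseteq> S ` {v \<in> E. n v \<le> 1})"

lemma topspace_weak_topology: "topspace weak_topology = UNIV"
proof -
  have "cblinfun_apply (0 :: 'a cdual) -` UNIV \<in> {cblinfun_apply \<phi> -` U | (\<phi> :: 'a cdual) U. open U}"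
    by blast
  then show ?thesis unfolding weak_topology_def topology_generated_by_topspace by blast
qed

lemma continuous_map_weak_scaleC:
  "continuous_map weak_topology weak_topology (\<lambda>x::'a::complex_normed_vector. a *\<^sub>C x)"
proof (subst (2) weak_topology_def, rule continuous_on_generated_topo)
  fix B :: "'a set" assume "B \<in> {cblinfun_apply \<phi> -` U | (\<phi> :: 'a cdual) U. open U}"
  then obtain \<phi> :: "'a cdual" and U where B: "B = cblinfun_apply \<phi> -` U" "open U" by blast
  have "cblinfun_apply \<phi> (a *\<^sub>C x) = cblinfun_apply (a *\<^sub>C \<phi>) x" for x
    using cblinfun_apply[of \<phi>] by (simp add: clinear_on_def scaleC_cblinfun.rep_eq)
  then have "(\<lambda>x. a *\<^sub>C x) -` B = cblinfun_apply (a *\<^sub>C \<phi>) -` U" using B by auto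
  then have "openin weak_topology ((\<lambda>x. a *\<^sub>C x) -` B)"
    unfolding weak_topology_def using B(2) by (intro topology_generated_by_Basis) blast
  then show "openin weak_topology ((\<lambda>x. a *\<^sub>C x) -` B \<inter> topspace weak_topology)"
    by (simp add: topspace_weak_topology)
next
  show "(\<lambda>x. a *\<^sub>C x) ` topspace weak_topology
      \<subseteq> \<Union> {cblinfun_apply \<phi> -` U | (\<phi> :: 'a cdual) U. open U}"
    using topspace_weak_topology[where 'a = 'a]
    unfolding weak_topology_def topology_generated_by_topspace by auto
qed

lemma relatively_weakly_compact_scaleC_subset:
  assumes A: "relatively_weakly_compact A" and "a \<noteq> 0" and B: "B \<subseteq> (\<lambda>x. a *\<^sub>C x) ` A"
  shows "relatively_weakly_compact B"
proof -
  let ?cA = "weak_topology closure_of A" and ?f = "\<lambda>x. a *\<^sub>C x"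
  have eq: "?f ` ?cA = (\<lambda>x. inverse a *\<^sub>C x) -` ?cA"
    using \<open>a \<noteq> 0\<close> by (force simp: scaleC_scaleC scaleC_one image_iff)
  have comp: "compactin weak_topology (?f ` ?cA)"
    by (rule image_compactin[OF A[unfolded relatively_weakly_compact_def] continuous_map_weak_scaleC])
  have closed: "closedin weak_topology (?f ` ?cA)"
    using closedin_continuous_map_preimage[OF continuous_map_weak_scaleC[of "inverse a"]
        closedin_closure_of[of weak_topology A]]
    by (simp add: eq topspace_weak_topology vimage_def)
  have "A \<subseteq> ?cA" by (rule closure_of_subset) (simp add: topspace_weak_topology)
  then have "B \<subseteq> ?f ` ?cA" using B by blast
  then have "weak_topology closure_of B \<subseteq> ?f ` ?cA"
    using closed by (rule closure_of_minimal)
  then show ?thesis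
    unfolding relatively_weakly_compact_def
    using closed_compactin[OF comp _ closedin_closure_of] by blast
qed

lemma W_bounded_setI:
  fixes E :: "'e::complex_vector set" and S :: "'e \<Rightarrow> 'y::complex_normed_vector"
  assumes ban: "complex_banach_on E n" and W: "weakly_compact_operator_on E n S"
    and K: "K \<subseteq> S ` {v \<in> E. n v \<le> 1}"
  shows "W_bounded_set K"
proof -
  from ban have nE: "complex_norm_on E n"
    and compl: "\<And>s. (\<forall>k::nat. s k \<in> E) \<Longrightarrow> (\<forall>e>0. \<exists>N. \<forall>i\<ge>N. \<forall>j\<ge>N. n (s i - s j) < e) \<Longrightarrow>
      \<exists>l\<in>E. (\<lambda>k. n (s k - l)) \<longlonglongrightarrow> 0"
    unfolding complex_banach_on_def by blast+
  have E0: "0 \<in> E" and Eadd: "\<And>x y. x \<in> E \<Longrightarrow> y \<in> E \<Longrightarrow> x + y \<in> E"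
    and Esc: "\<And>a x. x \<in> E \<Longrightarrow> a *\<^sub>C x \<in> E" and Ediff: "\<And>x y. x \<in> E \<Longrightarrow> y \<in> E \<Longrightarrow> x - y \<in> E"
    and Esum: "\<And>(d::nat \<Rightarrow> 'e) I. (\<And>i. d i \<in> E) \<Longrightarrow> sum d I \<in> E"
    using nE unfolding complex_norm_on_def
    by (auto intro: complex_vector.subspace_0 complex_vector.subspace_add
        complex_vector.subspace_scale complex_vector.subspace_diff complex_vector.subspace_sum)
  have n_pos: "\<And>x. x \<in> E \<Longrightarrow> 0 \<le> n x" and n_0: "n 0 = 0"
    and n_sc: "\<And>a x. x \<in> E \<Longrightarrow> n (a *\<^sub>C x) = cmod a * n x"
    and n_tri: "\<And>x y. x \<in> E \<Longrightarrow> y \<in> E \<Longrightarrow> n (x + y) \<le> n x + n y"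
    using nE E0 unfolding complex_norm_on_def by simp_all
  have n_minus: "n (x - y) = n (y - x)" if "x \<in> E" "y \<in> E" for x y
    using n_sc[OF Ediff[OF that], of "- 1"] by (simp add: scaleC_one)
  from W have S_add: "\<And>x y. x \<in> E \<Longrightarrow> y \<in> E \<Longrightarrow> S (x + y) = S x + S y"
    and S_sc: "\<And>a x. x \<in> E \<Longrightarrow> S (a *\<^sub>C x) = a *\<^sub>C S x"
    unfolding weakly_compact_operator_on_def clinear_on_def by blast+
  have S_0: "S 0 = 0" using S_sc[OF E0, of 0] by simp
  have S_diff: "S (x - y) = S x - S y" if "x \<in> E" "y \<in> E" for x y
    using S_add[OF that(1) Esc[OF that(2), of "- 1"]] S_sc[OF that(2), of "- 1"]
    by (simp add: scaleC_one)
  from W obtain C0 where C0: "\<And>v. v \<in> E \<Longrightarrow> norm (S v) \<le> C0 * n v"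
    unfolding weakly_compact_operator_on_def by blast
  define C where "C = max C0 1"
  have C: "norm (S v) \<le> C * n v" if "v \<in> E" for v
    using C0[OF that] mult_right_mono[of C0 C "n v"] n_pos[OF that] by (simp add: C_def)
  have "C > 0" by (simp add: C_def)

  define V where "V = S ` E"
  define q where "q = (\<lambda>v. INF e\<in>{e \<in> E. S e = v}. n e)"
  have q_le: "q v \<le> n e" if "e \<in> E" "S e = v" for e v
    unfolding q_def by (rule cINF_lower) (use that n_pos in \<open>auto intro!: bdd_belowI2[where m = 0]\<close>)
  have q_lt: "\<exists>e\<in>E. S e = v \<and> n e < r" if "v \<in> V" "q v < r" for v r
    using cInf_lessD[of "n ` {e \<in> E. S e = v}" r] that unfolding V_def q_def by auto
  have q_ge: "b \<le> q v" if "v \<in> V" "\<And>e. e \<in> E \<Longrightarrow> S e = v \<Longrightarrow> b \<le> n e" for v b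
    unfolding q_def by (rule cINF_greatest) (use that in \<open>auto simp: V_def\<close>)
  have q_pos: "0 \<le> q v" if "v \<in> V" for v using q_ge[OF that] n_pos by blast
  have Cq: "norm v \<le> C * q v" if "v \<in> V" for v
    using q_ge[OF that, of "norm v / C"] C \<open>C > 0\<close> by (auto simp: field_simps)
  have V_add: "u + v \<in> V" if "u \<in> V" "v \<in> V" for u v
  proof -
    from that obtain d e where "d \<in> E" "u = S d" "e \<in> E" "v = S e" unfolding V_def by blast
    then show ?thesis unfolding V_def using S_add[of d e] Eadd[of d e]
      by (intro image_eqI[of _ S "d + e"]) simp_all
  qed
  have V_sc: "a *\<^sub>C v \<in> V" if "v \<in> V" for a v
  proof -
    from that obtain e where "e \<in> E" "v = S e" unfolding V_def by blast
    then show ?thesis unfolding V_def using S_sc[of e a] Esc[of e a]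
      by (intro image_eqI[of _ S "a *\<^sub>C e"]) simp_all
  qed
  have V_diff: "u - v \<in> V" if "u \<in> V" "v \<in> V" for u v
  proof -
    from that obtain d e where "d \<in> E" "u = S d" "e \<in> E" "v = S e" unfolding V_def by blast
    then show ?thesis unfolding V_def using S_diff[of d e] Ediff[of d e]
      by (intro image_eqI[of _ S "d - e"]) simp_all
  qed
  have V_0: "0 \<in> V" unfolding V_def using E0 S_0 by (intro image_eqI[of _ S 0]) simp_all
  have q_tri: "q (u + v) \<le> q u + q v" if uv: "u \<in> V" "v \<in> V" for u v
  proof (rule field_le_epsilon)
    fix \<epsilon> :: real assume "\<epsilon> > 0"
    then obtain d e where "d \<in> E" "S d = u" "n d < q u + \<epsilon> / 2" "e \<in> E" "S e = v" "n e < q v + \<epsilon> / 2"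
      using q_lt[OF uv(1), of "q u + \<epsilon> / 2"] q_lt[OF uv(2), of "q v + \<epsilon> / 2"] by auto
    then show "q (u + v) \<le> q u + q v + \<epsilon>"
      using q_le[of "d + e" "u + v"] n_tri[of d e] Eadd S_add by force
  qed
  have q_sc_le: "q (a *\<^sub>C v) \<le> cmod a * q v" if "v \<in> V" for a v
  proof (cases "a = 0")
    case True
    then show ?thesis using q_le[OF E0 S_0] n_0 by simp
  next
    case False
    have "q (a *\<^sub>C v) / cmod a \<le> q v"
    proof (rule q_ge[OF that])
      fix e assume "e \<in> E" "S e = v"
      then show "q (a *\<^sub>C v) / cmod a \<le> n e"
        using q_le[of "a *\<^sub>C e" "a *\<^sub>C v"] False by (simp add: Esc S_sc n_sc field_simps)
    qed
    with False show ?thesis by (simp add: field_simps)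
  qed
  have q_sc: "q (a *\<^sub>C v) = cmod a * q v" if v: "v \<in> V" for a v
  proof (cases "a = 0")
    case True
    then show ?thesis using q_sc_le[OF v, of 0] q_pos[OF V_0] by simp
  next
    case False
    then have "q v \<le> cmod (inverse a) * q (a *\<^sub>C v)"
      using q_sc_le[OF V_sc[OF v], of "inverse a" a] by (simp add: scaleC_scaleC scaleC_one)
    then have "cmod a * q v \<le> q (a *\<^sub>C v)" using False by (simp add: norm_divide field_simps)
    with q_sc_le[OF v] show ?thesis by (simp add: antisym)
  qed
  have nV: "complex_norm_on V q"
    unfolding complex_norm_on_def
  proof (intro conjI ballI allI)
    show "complex_vector.subspace V"
      unfolding complex_vector.subspace_def using V_0 V_add V_sc by blast
    show "q v = 0 \<longleftrightarrow> v = 0" if "v \<in> V" for v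
      using Cq[OF that] q_le[OF E0 S_0] q_pos[OF V_0] n_0 by auto
  qed (use q_pos q_sc q_tri in auto)
  moreover have "\<exists>l\<in>V. (\<lambda>k. q (s k - l)) \<longlonglongrightarrow> 0"
    if sV: "\<forall>k::nat. s k \<in> V" and cau: "\<forall>e>0. \<exists>N. \<forall>i\<ge>N. \<forall>j\<ge>N. q (s i - s j) < e" for s
  proof -
    have "\<forall>k. \<exists>N. \<forall>i\<ge>N. \<forall>j\<ge>N. q (s i - s j) < (1 / 2) ^ k" using cau by simp
    then obtain N where N: "\<And>k i j. i \<ge> N k \<Longrightarrow> j \<ge> N k \<Longrightarrow> q (s i - s j) < (1 / 2) ^ k" by metis
    define r where "r k = k + (\<Sum>i\<le>k. N i)" for k
    have r: "r k \<ge> k" "r k \<ge> N k" "r (Suc k) \<ge> N k" for k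
      using member_le_sum[of k "{..k}" N] by (auto simp: r_def)
    have "\<exists>d\<in>E. S d = s (r (Suc k)) - s (r k) \<and> n d < (1 / 2) ^ k" for k
      using q_lt[OF V_diff N[OF r(3) r(2)]] sV by blast
    then obtain d where d: "\<And>k. d k \<in> E" "\<And>k. S (d k) = s (r (Suc k)) - s (r k)"
      "\<And>k. n (d k) < (1 / 2) ^ k" by metis
    obtain e0 where e0: "e0 \<in> E" "S e0 = s (r 0)" using sV unfolding V_def by (metis imageE)
    define t where "t k = e0 + (\<Sum>i<k. d i)" for k
    have tE: "t k \<in> E" for k unfolding t_def by (intro Eadd e0 Esum d)
    have tS: "S (t k) = s (r k)" for k
    proof (induction k)
      case 0
      show ?case by (simp add: t_def e0)
    next
      case (Suc k)
      have "t (Suc k) = t k + d k" by (simp add: t_def add.assoc)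
      then show ?case using S_add[OF tE d(1), of k k] Suc d(2)[of k] by simp
    qed
    have tn: "n (t (k + m) - t k) \<le> 2 * (1 / 2) ^ k - 2 * (1 / 2) ^ (k + m)" for k m
    proof (induction m)
      case 0
      show ?case by (simp add: n_0)
    next
      case (Suc m)
      have eq: "t (k + Suc m) - t k = (t (k + m) - t k) + d (k + m)"
        by (simp add: t_def algebra_simps)
      show ?case
        unfolding eq using n_tri[OF Ediff[OF tE tE] d(1), of "k + m" k "k + m"] Suc d(3)[of "k + m"]
        by simp
    qed
    have tn': "n (t i - t k) \<le> 2 * (1 / 2) ^ k" if "k \<le> i" for i k
    proof -
      have "0 \<le> (1 / 2 :: real) ^ i" by (rule zero_le_power) simp
      moreover have "n (t i - t k) \<le> 2 * (1 / 2) ^ k - 2 * (1 / 2) ^ i"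
        using tn[of k "i - k"] that by simp
      ultimately show ?thesis by linarith
    qed
    have "\<exists>l\<in>E. (\<lambda>k. n (t k - l)) \<longlonglongrightarrow> 0"
    proof (rule compl, use tE in blast, intro allI impI)
      fix \<epsilon> :: real assume "\<epsilon> > 0"
      then obtain k where k: "(1 / 2) ^ k < \<epsilon> / 4"
        using real_arch_pow_inv[of "\<epsilon> / 4" "1 / 2"] by auto
      have "n (t i - t j) < \<epsilon>" if "i \<ge> k" "j \<ge> k" for i j
      proof -
        have "n (t i - t j) \<le> n (t i - t k) + n (t k - t j)"
          using n_tri[OF Ediff[OF tE tE] Ediff[OF tE tE], of i k k j] by simp
        then show ?thesis using tn'[OF that(1)] tn'[OF that(2)] k n_minus[OF tE tE, of k j] by simp
      qed
      then show "\<exists>N. \<forall>i\<ge>N. \<forall>j\<ge>N. n (t i - t j) < \<epsilon>" by blast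
    qed
    then obtain l where l: "l \<in> E" "(\<lambda>k. n (t k - l)) \<longlonglongrightarrow> 0" by blast
    have SlV: "S l \<in> V" using l(1) by (simp add: V_def)
    have "(\<lambda>k. q (s k - S l)) \<longlonglongrightarrow> 0"
    proof (rule LIMSEQ_I)
      fix \<epsilon> :: real assume "\<epsilon> > 0"
      then obtain M where M: "\<And>i j. i \<ge> M \<Longrightarrow> j \<ge> M \<Longrightarrow> q (s i - s j) < \<epsilon> / 2"
        using cau half_gt_zero by metis
      obtain M' where M': "\<And>k. k \<ge> M' \<Longrightarrow> norm (n (t k - l) - 0) < \<epsilon> / 2"
        using LIMSEQ_D[OF l(2), of "\<epsilon> / 2"] \<open>\<epsilon> > 0\<close> by auto
      define m where "m = max M M'"
      have "q (s (r m) - S l) \<le> n (t m - l)"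
        by (rule q_le) (simp_all add: Ediff tE l S_diff tS)
      then have m: "q (s (r m) - S l) < \<epsilon> / 2" using M'[of m] by (simp add: m_def)
      have "norm (q (s k - S l) - 0) < \<epsilon>" if "k \<ge> M" for k
      proof -
        have "q (s k - S l) \<le> q (s k - s (r m)) + q (s (r m) - S l)"
          using q_tri[OF V_diff V_diff, of "s k" "s (r m)" "s (r m)" "S l"] sV SlV by simp
        moreover have "q (s k - s (r m)) < \<epsilon> / 2"
          using M[OF that] r(1)[of m] by (simp add: m_def)
        ultimately show ?thesis using m q_pos[OF V_diff, of "s k" "S l"] sV SlV by simp
      qed
      then show "\<exists>no. \<forall>k\<ge>no. norm (q (s k - S l) - 0) < \<epsilon>" by blast
    qed
    then show ?thesis using SlV by blast
  qed
  ultimately have banV: "complex_banach_on V q" unfolding complex_banach_on_def by blast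

  have "{v \<in> V. q v \<le> 1} \<subseteq> (\<lambda>x. 2 *\<^sub>C x) ` S ` {v \<in> E. n v \<le> 1}"
  proof
    fix v assume v: "v \<in> {v \<in> V. q v \<le> 1}"
    then obtain e where e: "e \<in> E" "S e = v" "n e < 2" using q_lt[of v 2] by auto
    have "(1 / 2) *\<^sub>C e \<in> {v \<in> E. n v \<le> 1}" using e by (simp add: Esc n_sc norm_divide)
    moreover have "v = 2 *\<^sub>C S ((1 / 2) *\<^sub>C e)"
      using e by (simp add: S_sc scaleC_scaleC scaleC_one)
    ultimately show "v \<in> (\<lambda>x. 2 *\<^sub>C x) ` S ` {v \<in> E. n v \<le> 1}" by blast
  qed
  with W have "relatively_weakly_compact {v \<in> V. q v \<le> 1}"
    unfolding weakly_compact_operator_on_def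
    using relatively_weakly_compact_scaleC_subset[of "S ` {v \<in> E. n v \<le> 1}" 2] by simp
  then have "weakly_compact_operator_on V q (\<lambda>v. v)"
    unfolding weakly_compact_operator_on_def clinear_on_def using Cq by auto
  moreover have "K \<subseteq> (\<lambda>v. v) ` {v \<in> V. q v \<le> 1}"
  proof
    fix k assume "k \<in> K"
    then obtain e where "e \<in> E" "n e \<le> 1" "k = S e" using K by blast
    then show "k \<in> (\<lambda>v. v) ` {v \<in> V. q v \<le> 1}"
      using q_le[of e k] by (auto simp: V_def)
  qed
  ultimately show ?thesis using banV unfolding W_bounded_set_def by blast
qed

text \<open>In particular, any operator between Banach space types may be used.\<close>

lemma complex_banach_on_UNIV: "complex_banach_on (UNIV :: 'e::complex_banach set) norm"
  unfolding complex_banach_on_def complex_norm_on_def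
proof (intro conjI allI impI)
  fix s :: "nat \<Rightarrow> 'e" assume "\<forall>e>0. \<exists>N. \<forall>i\<ge>N. \<forall>j\<ge>N. norm (s i - s j) < e"
  then have "Cauchy s" by (simp add: Cauchy_iff)
  then obtain l where "s \<longlonglongrightarrow> l" using Cauchy_convergent convergent_def by blast
  then have "(\<lambda>k. norm (s k - l)) \<longlonglongrightarrow> 0" using LIM_zero tendsto_norm_zero by blast
  then show "\<exists>l\<in>UNIV. (\<lambda>k. norm (s k - l)) \<longlonglongrightarrow> 0" by blast
qed (auto simp: norm_scaleC norm_triangle_ineq)

lemma W_bounded_set_image_cball:
  fixes S :: "'e::complex_banach \<Rightarrow> 'y::complex_normed_vector"
  assumes "bounded_linear S" "clinear_on UNIV S" "relatively_weakly_compact (S ` cball 0 1)"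
    and "K \<subseteq> S ` cball 0 1"
  shows "W_bounded_set K"
proof (rule W_bounded_setI[OF complex_banach_on_UNIV])
  have ball: "{v \<in> UNIV. norm v \<le> 1} = cball (0::'e) 1" by auto
  show "K \<subseteq> S ` {v \<in> UNIV. norm v \<le> 1}" using assms(4) unfolding ball .
  obtain C where "\<And>v. norm (S v) \<le> norm v * C" using bounded_linear.bounded[OF assms(1)] by blast
  then show "weakly_compact_operator_on UNIV norm S"
    using assms(2,3) unfolding weakly_compact_operator_on_def ball by (auto simp: mult.commute)
qed

definition weakly_compact_hlip0 :: "('x::complex_normed_vector, 'y::complex_normed_vector) hlip0 set"
  where "weakly_compact_hlip0 = {f. W_bounded_set (lip_image f)}"

section \<open>The transpose\<close>

lemma holomorphic_map_on_cblinfun_compose: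
  assumes "holomorphic_map_on f U"
  shows "holomorphic_map_on (cblinfun_apply \<phi> \<circ> f) U"
  unfolding holomorphic_map_on_def
proof
  fix x assume "x \<in> U"
  then obtain D where D: "(f has_derivative cblinfun_apply D) (at x)"
    using assms unfolding holomorphic_map_on_def by blast
  have \<phi>: "bounded_linear (cblinfun_apply \<phi>)" "clinear_on UNIV (cblinfun_apply \<phi>)"
    and D': "bounded_linear (cblinfun_apply D)" "clinear_on UNIV (cblinfun_apply D)"
    using cblinfun_apply[of \<phi>] cblinfun_apply[of D] by auto
  have "cblinfun_apply (CBlinfun (\<lambda>h. cblinfun_apply \<phi> (cblinfun_apply D h))) =
      (\<lambda>h. cblinfun_apply \<phi> (cblinfun_apply D h))"
    by (rule CBlinfun_inverse)
      (use \<phi> D' in \<open>auto simp: clinear_on_def intro: bounded_linear_compose\<close>)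
  moreover have "((\<lambda>x. cblinfun_apply \<phi> (f x)) has_derivative
      (\<lambda>h. cblinfun_apply \<phi> (cblinfun_apply D h))) (at x)"
    by (rule bounded_linear.has_derivative[OF \<phi>(1) D])
  ultimately show "\<exists>D. (cblinfun_apply \<phi> \<circ> f has_derivative cblinfun_apply D) (at x)"
    unfolding comp_def by metis
qed

lift_definition transpose_hlip0 ::
    "('x::complex_normed_vector, 'y::complex_normed_vector) hlip0 \<Rightarrow> 'y cdual \<Rightarrow> ('x, complex) hlip0"
  is "\<lambda>f \<phi>. cblinfun_apply \<phi> \<circ> f"
proof -
  fix f :: "'x \<Rightarrow> 'y" and \<phi> :: "'y cdual"
  assume f: "holomorphic_map_on f (ball 0 1) \<and> (\<exists>K. K-lipschitz_on (ball 0 1) f) \<and> f 0 = 0 \<and>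
    (\<forall>x. x \<notin> ball 0 1 \<longrightarrow> f x = 0)"
  then obtain K where K: "K-lipschitz_on (ball 0 1) f" by blast
  have bl: "bounded_linear (cblinfun_apply \<phi>)" using cblinfun_apply[of \<phi>] by simp
  then obtain C where C: "C-lipschitz_on (f ` ball 0 1) (cblinfun_apply \<phi>)"
    using bounded_linear.lipschitz_boundE by blast
  show "holomorphic_map_on (cblinfun_apply \<phi> \<circ> f) (ball 0 1) \<and>
    (\<exists>K. K-lipschitz_on (ball 0 1) (cblinfun_apply \<phi> \<circ> f)) \<and> (cblinfun_apply \<phi> \<circ> f) 0 = 0 \<and>
    (\<forall>x. x \<notin> ball 0 1 \<longrightarrow> (cblinfun_apply \<phi> \<circ> f) x = 0)"
    using f lipschitz_on_compose[OF K C] bl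
    by (auto simp: holomorphic_map_on_cblinfun_compose linear_simps)
qed

end

theory Submission
  imports Defs "HOL-Complex_Analysis.Cauchy_Integral_Formula"
begin

text \<open>
  Write \<open>H\<close> for the space of scalar holomorphic Lipschitz functions on the ball of \<open>X\<close>. A linear map
  \<open>T\<close> from \<open>Y\<^sup>*\<close> to \<open>H\<close> is weak*-to-weak continuous exactly when every functional \<open>F\<close> on \<open>H\<close> pulls back to
  the evaluation at some point of \<open>Y\<close> (\<open>weak_star_weak_operators_iff\<close>), that is, when \<open>T\<close> is the adjoint
  of a linear map \<open>S\<close> from \<open>H\<^sup>*\<close> to \<open>Y\<close>.

  \<^emph>\<open>The transpose is weak*-to-weak continuous.\<close> For weakly compact \<open>f\<close>, the Lipschitz image lies in an
  absolutely convex, relatively weakly compact set \<open>D\<close>, the image of a unit ball. The Lipschitz norm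
  of \<open>\<phi> \<circ> f\<close> is the supremum of \<open>\<bar>\<phi>\<bar>\<close> over the Lipschitz image, so \<open>\<phi> \<mapsto> F (\<phi> \<circ> f)\<close> is dominated by a
  multiple of the supremum of \<open>\<bar>\<phi>\<bar>\<close> over \<open>D\<close>. A functional on \<open>Y\<^sup>*\<close> dominated in this way is evaluation
  at a point of \<open>Y\<close> (\<open>dominated_functional_represented\<close>).

  \<^emph>\<open>Every weak*-to-weak continuous operator is a transpose.\<close> The evaluations \<open>x \<mapsto> (g \<mapsto> g x)\<close> form a
  holomorphic Lipschitz map from the ball into \<open>H\<^sup>*\<close> (\<open>universal_hlip0\<close>): by Cauchy's inequality on complex
  lines, the second-order Taylor remainder of \<open>g\<close> is controlled by the Lipschitz norm of \<open>g\<close> alone, so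
  the difference quotients converge in the norm of \<open>H\<^sup>*\<close>. If \<open>T\<close> is the adjoint of \<open>S\<close>, then \<open>S\<close> is bounded
  by the uniform boundedness principle (\<open>weakly_bounded_imp_bounded\<close>), so its composition \<open>f\<close> with the
  evaluation map is holomorphic and Lipschitz, and the transpose of \<open>f\<close> is \<open>T\<close>. The difference quotients of the evaluation map have norm at
  most \<open>1\<close>, so the Lipschitz image of \<open>f\<close> lies in the image under \<open>S\<close> of the unit ball of \<open>H\<^sup>*\<close>, which is
  weakly compact by Banach--Alaoglu (\<open>weakly_compact_image_dual_ball\<close>). Hence \<open>S\<close> itself is the weakly
  compact operator that witnesses the weak compactness of \<open>f\<close>.

  Isometry and injectivity follow from norming functionals (\<open>norming_functional\<close>). The
  correspondence also transfers the linear structure: the weak*-to-weak continuous operators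
  visibly form a subspace, so the weakly compact maps do.
\<close>

section \<open>Bounded complex-linear maps\<close>

lemma cblinfun_bounded_linear: "bounded_linear (cblinfun_apply \<phi>)"
  using cblinfun_apply[of \<phi>] by simp

lemma cblinfun_clinear: "clinear_on UNIV (cblinfun_apply \<phi>)"
  using cblinfun_apply[of \<phi>] by simp

lemma cblinfun_add: "cblinfun_apply \<phi> (x + y) = cblinfun_apply \<phi> x + cblinfun_apply \<phi> y"
  and cblinfun_diff: "cblinfun_apply \<phi> (x - y) = cblinfun_apply \<phi> x - cblinfun_apply \<phi> y"
  and cblinfun_0: "cblinfun_apply \<phi> 0 = 0"
  and cblinfun_scaleR: "cblinfun_apply \<phi> (r *\<^sub>R x) = r *\<^sub>R cblinfun_apply \<phi> x"
  using cblinfun_bounded_linear[of \<phi>] by (simp_all add: linear_simps)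

lemma cblinfun_scaleC: "cblinfun_apply \<phi> (a *\<^sub>C x) = a *\<^sub>C cblinfun_apply \<phi> x"
  using cblinfun_clinear[of \<phi>] by (simp add: clinear_on_def)

lemmas cblinfun_simps = cblinfun_add cblinfun_diff cblinfun_0 cblinfun_scaleR cblinfun_scaleC

lemmas cblinfun_ops = plus_cblinfun.rep_eq minus_cblinfun.rep_eq zero_cblinfun.rep_eq
  scaleC_cblinfun.rep_eq uminus_cblinfun.rep_eq

lemma cblinfun_eqI: "(\<And>x. cblinfun_apply \<phi> x = cblinfun_apply \<psi> x) \<Longrightarrow> \<phi> = \<psi>"
  by (simp add: cblinfun_apply_inject[symmetric] fun_eq_iff)

lemma norm_cblinfun_le: "norm (cblinfun_apply \<phi> x) \<le> norm \<phi> * norm x"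
  unfolding norm_cblinfun.rep_eq by (rule onorm[OF cblinfun_bounded_linear])

lemma norm_cblinfun_leI:
  assumes "0 \<le> b" "\<And>x. norm (cblinfun_apply \<phi> x) \<le> b * norm x"
  shows "norm \<phi> \<le> b"
  unfolding norm_cblinfun.rep_eq by (rule onorm_bound[OF assms])

lemma clinear_on_imp_bounded_linear:
  fixes f :: "'a::complex_normed_vector \<Rightarrow> 'b::complex_normed_vector"
  assumes "clinear_on UNIV f" "\<And>x. norm (f x) \<le> b * norm x"
  shows "bounded_linear f"
  using assms
  by (intro bounded_linear_intro[where K = b]) (auto simp: clinear_on_def scaleR_scaleC mult.commute)

lemma cblinfun_apply_CBlinfun:
  fixes f :: "'a::complex_normed_vector \<Rightarrow> 'b::complex_normed_vector"
  assumes "clinear_on UNIV f" "\<And>x. norm (f x) \<le> b * norm x"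
  shows "cblinfun_apply (CBlinfun f) = f"
  using assms clinear_on_imp_bounded_linear[OF assms] by (intro CBlinfun_inverse) simp

lemma clinear_on_simps:
  fixes f :: "'a::complex_vector \<Rightarrow> 'b::complex_vector"
  assumes "clinear_on UNIV f"
  shows "f (x + y) = f x + f y" "f (a *\<^sub>C x) = a *\<^sub>C f x" "f 0 = 0" "f (x - y) = f x - f y"
proof -
  show add: "f (x + y) = f x + f y" for x y using assms by (simp add: clinear_on_def)
  show sc: "f (a *\<^sub>C x) = a *\<^sub>C f x" for a x using assms by (simp add: clinear_on_def)
  show "f 0 = 0" using sc[of 0 0] by simp
  show "f (x - y) = f x - f y" using add[of "x - y" y] by simp
qed

text \<open>Completeness of the dual serves twice: the dual of the scalar function space is the Banach space
  through which a holomorphic map factors, and the uniform boundedness principle takes a limit in the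
  dual of \<open>Y\<close>.\<close>

instance cblinfun :: (complex_normed_vector, complex_banach) complex_banach
proof
  fix \<phi> :: "nat \<Rightarrow> ('a, 'b) cblinfun"
  assume C: "Cauchy \<phi>"
  have le: "norm (cblinfun_apply (\<phi> m) x - cblinfun_apply (\<phi> n) x) \<le> norm (\<phi> m - \<phi> n) * norm x"
    for m n x using norm_cblinfun_le[of "\<phi> m - \<phi> n" x] by (simp add: cblinfun_ops)
  have "Cauchy (\<lambda>n. cblinfun_apply (\<phi> n) x)" for x
  proof (rule CauchyI)
    fix e :: real assume "e > 0"
    then have e: "e / (norm x + 1) > 0" by (simp add: add_nonneg_pos)
    obtain N where N: "\<And>m n. m \<ge> N \<Longrightarrow> n \<ge> N \<Longrightarrow> norm (\<phi> m - \<phi> n) < e / (norm x + 1)"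
      using CauchyD[OF C e] by blast
    have "norm (cblinfun_apply (\<phi> m) x - cblinfun_apply (\<phi> n) x) < e" if "m \<ge> N" "n \<ge> N" for m n
    proof -
      have "norm (cblinfun_apply (\<phi> m) x - cblinfun_apply (\<phi> n) x) \<le> norm (\<phi> m - \<phi> n) * norm x"
        by (rule le)
      also have "\<dots> \<le> norm (\<phi> m - \<phi> n) * (norm x + 1)"
        by (intro mult_left_mono) auto
      also have "\<dots> < e" using N[OF that] by (subst (asm) pos_less_divide_eq) (simp_all add: add_nonneg_pos)
      finally show ?thesis .
    qed
    then show "\<exists>M. \<forall>m\<ge>M. \<forall>n\<ge>M. norm (cblinfun_apply (\<phi> m) x - cblinfun_apply (\<phi> n) x) < e" by blast
  qed
  then have "\<forall>x. \<exists>l. (\<lambda>n. cblinfun_apply (\<phi> n) x) \<longlonglongrightarrow> l"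
    using Cauchy_convergent unfolding convergent_def by blast
  then obtain f where f: "\<And>x. (\<lambda>n. cblinfun_apply (\<phi> n) x) \<longlonglongrightarrow> f x" by metis
  have cl: "clinear_on UNIV f"
    unfolding clinear_on_def
  proof (intro conjI allI ballI)
    show "f (x + y) = f x + f y" for x y
      using LIMSEQ_unique[OF f[of "x + y"]] tendsto_add[OF f[of x] f[of y]] by (simp add: cblinfun_simps)
    show "f (a *\<^sub>C x) = a *\<^sub>C f x" for a x
      using LIMSEQ_unique[OF f[of "a *\<^sub>C x"]]
        bounded_linear.tendsto[OF bounded_linear_scaleC f[of x]] by (simp add: cblinfun_simps)
  qed
  \<comment> \<open>The pointwise estimates of the Cauchy condition survive the pointwise limit.\<close>
  have lim: "norm (cblinfun_apply (\<phi> m) x - f x) \<le> e * norm x"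
    if "\<And>n. n \<ge> N \<Longrightarrow> norm (\<phi> m - \<phi> n) \<le> e" for m N e x
  proof (rule Lim_bounded[where M = N])
    show "(\<lambda>n. norm (cblinfun_apply (\<phi> m) x - cblinfun_apply (\<phi> n) x)) \<longlonglongrightarrow> norm (cblinfun_apply (\<phi> m) x - f x)"
      by (intro tendsto_intros f)
    show "\<forall>n\<ge>N. norm (cblinfun_apply (\<phi> m) x - cblinfun_apply (\<phi> n) x) \<le> e * norm x"
      using le[of m x] that by (meson mult_right_mono norm_ge_zero order_trans)
  qed
  obtain N1 where N1: "\<And>m n. m \<ge> N1 \<Longrightarrow> n \<ge> N1 \<Longrightarrow> norm (\<phi> m - \<phi> n) < 1"
    using CauchyD[OF C, of 1] by auto
  have "norm (f x) \<le> (norm (\<phi> N1) + 1) * norm x" for x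
  proof -
    have "norm (cblinfun_apply (\<phi> N1) x - f x) \<le> 1 * norm x"
      by (rule lim[of N1]) (use N1 in force)
    then show ?thesis
      using norm_cblinfun_le[of "\<phi> N1" x] norm_triangle_ineq4[of "cblinfun_apply (\<phi> N1) x" "cblinfun_apply (\<phi> N1) x - f x"]
      by (simp add: algebra_simps)
  qed
  note F = cblinfun_apply_CBlinfun[OF cl this]
  have "\<phi> \<longlonglongrightarrow> CBlinfun f"
  proof (rule LIMSEQ_I)
    fix e :: real assume "e > 0"
    then obtain N where N: "\<And>m n. m \<ge> N \<Longrightarrow> n \<ge> N \<Longrightarrow> norm (\<phi> m - \<phi> n) < e / 2"
      using CauchyD[OF C, of "e / 2"] by auto
    have "norm (\<phi> m - CBlinfun f) \<le> e / 2" if "m \<ge> N" for m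
    proof (rule norm_cblinfun_leI)
      show "norm (cblinfun_apply (\<phi> m - CBlinfun f) x) \<le> e / 2 * norm x" for x
        unfolding minus_cblinfun.rep_eq F by (rule lim[of N]) (use N[OF that] in force)
    qed (use \<open>e > 0\<close> in simp)
    then show "\<exists>N. \<forall>m\<ge>N. norm (\<phi> m - CBlinfun f) < e" using \<open>e > 0\<close> by (fastforce intro: exI[of _ N])
  qed
  then show "convergent \<phi>" unfolding convergent_def by blast
qed

section \<open>Norming functionals\<close>

definition sublinear :: "('a::real_vector \<Rightarrow> real) \<Rightarrow> bool"
  where "sublinear p \<longleftrightarrow> (\<forall>x y. p (x + y) \<le> p x + p y) \<and> (\<forall>t\<ge>0. \<forall>x. p (t *\<^sub>R x) = t * p x)"

lemma sublinearD:
  assumes "sublinear p"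
  shows "p (x + y) \<le> p x + p y" "t \<ge> 0 \<Longrightarrow> p (t *\<^sub>R x) = t * p x" "p 0 = 0" "- p (- x) \<le> p x"
proof -
  show tri: "p (x + y) \<le> p x + p y" for x y using assms by (simp add: sublinear_def)
  show sc: "t \<ge> 0 \<Longrightarrow> p (t *\<^sub>R x) = t * p x" for t x using assms by (simp add: sublinear_def)
  show z: "p 0 = 0" using sc[of 0 0] by simp
  show "- p (- x) \<le> p x" using tri[of x "- x"] z by simp
qed

text \<open>Forcing a sublinear functional to be linear on the line through \<open>x\<close>: the lowered functional \<open>q\<close>
  takes the value \<open>- p x\<close> at \<open>- x\<close>. The infimum is finite, since \<open>- p (- y)\<close> is a lower bound.\<close>

lemma sublinear_lower:
  fixes p :: "'a::real_vector \<Rightarrow> real" and x :: 'a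
  assumes p: "sublinear p"
  defines "q \<equiv> \<lambda>y. INF t\<in>{0..}. p (y + t *\<^sub>R x) - t * p x"
  shows "sublinear q" "q y \<le> p y" "q (- x) \<le> - p x" "q y \<le> p (y + x) - p x"
proof -
  note pD = sublinearD[OF p]
  have lb: "- p (- y) \<le> p (y + t *\<^sub>R x) - t * p x" if "t \<ge> 0" for y t
    using pD(1)[of "y + t *\<^sub>R x" "- y"] pD(2)[OF that, of x] by simp
  have q_le: "q y \<le> p (y + t *\<^sub>R x) - t * p x" if "t \<ge> 0" for y t
    unfolding q_def by (rule cINF_lower) (use that lb in \<open>auto intro!: bdd_belowI2\<close>)
  have q_ge: "b \<le> q y" if "\<And>t. t \<ge> 0 \<Longrightarrow> b \<le> p (y + t *\<^sub>R x) - t * p x" for b y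
    unfolding q_def by (rule cINF_greatest) (use that in auto)
  show "q y \<le> p y" using q_le[of 0 y] by simp
  show "q (- x) \<le> - p x" using q_le[of 1 "- x"] pD(3) by simp
  show "q y \<le> p (y + x) - p x" using q_le[of 1 y] by simp
  show "sublinear q"
    unfolding sublinear_def
  proof (intro conjI allI impI)
    fix y z
    have "q (y + z) - (p (z + s *\<^sub>R x) - s * p x) \<le> q y" if s: "s \<ge> 0" for s
    proof (rule q_ge)
      fix t :: real assume t: "t \<ge> 0"
      have "y + z + (t + s) *\<^sub>R x = (y + t *\<^sub>R x) + (z + s *\<^sub>R x)" by (simp add: algebra_simps)
      then show "q (y + z) - (p (z + s *\<^sub>R x) - s * p x) \<le> p (y + t *\<^sub>R x) - t * p x"
        using q_le[of "t + s" "y + z"] s t pD(1)[of "y + t *\<^sub>R x" "z + s *\<^sub>R x"]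
        by (simp add: algebra_simps)
    qed
    then have "q (y + z) - q y \<le> q z" by (intro q_ge) (simp add: algebra_simps)
    then show "q (y + z) \<le> q y + q z" by simp
  next
    fix t :: real and y assume "t \<ge> 0"
    have q0: "q 0 = 0"
      using q_le[of 0 0] q_ge[of 0 0] pD(3) by (intro antisym) (simp_all add: pD(2))
    have le: "q (t *\<^sub>R y) \<le> t * q y" if t: "t > 0" for t y
    proof -
      have "q (t *\<^sub>R y) / t \<le> q y"
      proof (rule q_ge)
        fix s :: real assume s: "s \<ge> 0"
        have "p (t *\<^sub>R y + (t * s) *\<^sub>R x) = t * p (y + s *\<^sub>R x)"
          using pD(2)[of t "y + s *\<^sub>R x"] t by (simp add: scaleR_add_right)
        then show "q (t *\<^sub>R y) / t \<le> p (y + s *\<^sub>R x) - s * p x"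
          using q_le[of "t * s" "t *\<^sub>R y"] s t by (simp add: field_simps)
      qed
      then show ?thesis using t by (simp add: field_simps)
    qed
    show "q (t *\<^sub>R y) = t * q y"
    proof (cases "t = 0")
      case False
      then have t: "t > 0" using \<open>t \<ge> 0\<close> by simp
      show ?thesis
        using le[OF t, of y] le[of "inverse t" "t *\<^sub>R y"] t by (simp add: field_simps)
    qed (simp add: q0)
  qed
qed

text \<open>A minimal sublinear functional \<open>m\<close> agrees with its lowering along the line through any \<open>x\<close>, so
  \<open>m y \<le> m (y + x) - m x\<close>, the missing half of additivity.
  Zorn's lemma provides minimal ones: the pointwise infimum of a chain is sublinear, and it is finite
  because \<open>- q (- x) \<le> q x\<close> and \<open>q \<le> p\<close> bound \<open>q x\<close> below by \<open>- p (- x)\<close>.\<close>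

lemma linear_below_sublinear:
  fixes p :: "'a::real_vector \<Rightarrow> real"
  assumes p: "sublinear p"
  obtains l where "linear l" "\<And>x. l x \<le> p x"
proof -
  define A where "A = {q. sublinear q \<and> (\<forall>x. q x \<le> p x)}"
  define P where "P = (\<lambda>q q' :: 'a \<Rightarrow> real. \<forall>x. q' x \<le> q x)"
  have "\<exists>m\<in>A. \<forall>q\<in>A. P m q \<longrightarrow> q = m"
  proof (rule predicate_Zorn)
    show "partial_order_on A (relation_of P A)"
      by (rule partial_order_on_relation_ofI)
        (simp_all add: P_def fun_eq_iff order_antisym, meson order_trans)
    fix C assume C: "C \<in> Chains (relation_of P A)"
    then have CA: "C \<subseteq> A" by (auto simp: Chains_def relation_of_def)
    show "\<exists>u\<in>A. \<forall>q\<in>C. P q u"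
    proof (cases "C = {}")
      case True
      then show ?thesis using p by (auto simp: A_def)
    next
      case False
      define u where "u = (\<lambda>x. INF q\<in>C. q x)"
      have lb: "- p (- x) \<le> q x" if "q \<in> C" for q x
      proof -
        have "sublinear q" "q (- x) \<le> p (- x)" using that CA by (auto simp: A_def)
        then show ?thesis using sublinearD(4)[of q x] by linarith
      qed
      have u_le: "u x \<le> q x" if "q \<in> C" for q x
        unfolding u_def by (rule cINF_lower) (use that lb in \<open>auto intro!: bdd_belowI2\<close>)
      have u_ge: "b \<le> u x" if "\<And>q. q \<in> C \<Longrightarrow> b \<le> q x" for b x
        unfolding u_def by (rule cINF_greatest) (use that False in auto)
      have sub: "sublinear q" if "q \<in> C" for q using that CA by (auto simp: A_def)
      have "sublinear u"
        unfolding sublinear_def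
      proof (intro conjI allI impI)
        fix x y
        have "u (x + y) - q y \<le> u x" if q: "q \<in> C" for q
        proof (rule u_ge)
          fix r assume r: "r \<in> C"
          then have "P q r \<or> P r q" using C q by (auto simp: Chains_def relation_of_def)
          then show "u (x + y) - q y \<le> r x"
          proof
            assume "P q r"
            then have "r y \<le> q y" by (simp add: P_def)
            then show ?thesis
              using u_le[OF r, of "x + y"] sublinearD(1)[OF sub[OF r], of x y] by linarith
          next
            assume "P r q"
            then have "q x \<le> r x" by (simp add: P_def)
            then show ?thesis
              using u_le[OF q, of "x + y"] sublinearD(1)[OF sub[OF q], of x y] by linarith
          qed
        qed
        then have "u (x + y) - u x \<le> u y" by (intro u_ge) (simp add: algebra_simps)
        then show "u (x + y) \<le> u x + u y" by simp
      next
        fix t :: real and x assume "t \<ge> 0"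
        show "u (t *\<^sub>R x) = t * u x"
        proof (cases "t = 0")
          case True
          obtain q where "q \<in> C" using False by blast
          have "u 0 = 0"
            using u_le[OF \<open>q \<in> C\<close>, of 0] u_ge[of 0 0] sub sublinearD(3) \<open>q \<in> C\<close> by (metis antisym order_refl)
          then show ?thesis using True by simp
        next
          case nz: False
          have le: "s * u y \<le> u (s *\<^sub>R y)" if "s > 0" for s y
          proof (rule u_ge)
            fix q assume q: "q \<in> C"
            show "s * u y \<le> q (s *\<^sub>R y)"
              using that u_le[OF q, of y] sublinearD(2)[OF sub[OF q], of s y] by simp
          qed
          show ?thesis
            using le[of t x] le[of "inverse t" "t *\<^sub>R x"] \<open>t \<ge> 0\<close> nz by (simp add: field_simps)
        qed
      qed
      moreover obtain q where "q \<in> C" using False by blast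
      moreover have "q x \<le> p x" for x using \<open>q \<in> C\<close> CA by (auto simp: A_def)
      ultimately have "u \<in> A" using u_le order_trans unfolding A_def by blast
      then show ?thesis using u_le by (auto simp: P_def)
    qed
  qed
  then obtain m where m: "m \<in> A" and mmin: "\<And>q. q \<in> A \<Longrightarrow> (\<And>x. q x \<le> m x) \<Longrightarrow> q = m"
    by (auto simp: P_def)
  have sm: "sublinear m" and mp: "\<And>x. m x \<le> p x" using m by (auto simp: A_def)
  have add: "m (x + y) = m x + m y" for x y
  proof (rule antisym)
    let ?q = "\<lambda>y. INF t\<in>{0..}. m (y + t *\<^sub>R x) - t * m x"
    have "?q \<in> A" using sublinear_lower(1,2)[OF sm] mp order_trans unfolding A_def by blast
    then have "?q = m" using sublinear_lower(2)[OF sm] by (intro mmin)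
    then have "m y \<le> m (y + x) - m x" using sublinear_lower(4)[OF sm, of y x] by (simp add: fun_eq_iff)
    then show "m x + m y \<le> m (x + y)" by (simp add: add.commute)
  qed (rule sublinearD(1)[OF sm])
  have neg: "m (- x) = - m x" for x using add[of x "- x"] sublinearD(3)[OF sm] by simp
  have "linear m"
  proof (rule linearI)
    show "m (t *\<^sub>R x) = t *\<^sub>R m x" for t x
      using sublinearD(2)[OF sm, of t x] sublinearD(2)[OF sm, of "- t" x] neg[of "t *\<^sub>R x"]
      by (cases "t \<ge> 0") auto
  qed (rule add)
  then show ?thesis using mp that by blast
qed

lemma complex_rotation: obtains a where "cmod a = 1" "a * z = of_real (cmod z)"
proof (cases "z = 0")
  case True
  then show ?thesis using that[of 1] by simp
next
  case False
  have "cnj (sgn z) * z = of_real (cmod z)"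
    using False
    by (simp add: sgn_eq complex_norm_square[symmetric] power2_eq_square mult.commute[of "cnj _"])
  moreover have "cmod (cnj (sgn z)) = 1" using False by (simp add: norm_sgn)
  ultimately show ?thesis using that by blast
qed

text \<open>Complex Hahn--Banach: a real functional \<open>l \<le> norm\<close> with \<open>l y = norm y\<close> comes from the norm lowered
  along the line through \<open>y\<close>, and \<open>l\<close> is the real part of the complex functional
  \<open>l x - i l (i x)\<close>.\<close>

lemma norming_functional:
  fixes y :: "'a::complex_normed_vector"
  obtains \<phi> :: "'a cdual" where "norm \<phi> \<le> 1" "cblinfun_apply \<phi> y = of_real (norm y)"
proof -
  have "sublinear (norm :: 'a \<Rightarrow> real)" by (simp add: sublinear_def norm_triangle_ineq)
  note low = sublinear_lower[OF this, where x = y]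
  obtain l where l: "linear l" "\<And>x. l x \<le> (INF t\<in>{0..}. norm (x + t *\<^sub>R y) - t * norm y)"
    using linear_below_sublinear[OF low(1)] by blast
  have l_le: "l x \<le> norm x" for x using l(2)[of x] low(2)[of x] by linarith
  have "l (- y) \<le> - norm y" using l(2)[of "- y"] low(3) by linarith
  then have ly: "l y = norm y" using l_le[of y] linear_neg[OF l(1), of y] by simp
  define f where "f x = Complex (l x) (- l (\<i> *\<^sub>C x))" for x
  have cl: "clinear_on UNIV f"
    unfolding clinear_on_def
  proof (intro conjI allI ballI)
    show "f (x + z) = f x + f z" for x z
      by (simp add: f_def complex_eq_iff linear_add[OF l(1)] scaleC_add_right)
    fix a x
    have sc: "l (b *\<^sub>C x) = Re b * l x + Im b * l (\<i> *\<^sub>C x)" for b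
    proof -
      have "b *\<^sub>C x = Re b *\<^sub>R x + Im b *\<^sub>R (\<i> *\<^sub>C x)"
        unfolding scaleR_scaleC scaleC_scaleC scaleC_add_left[symmetric]
        by (metis complex_eq mult.commute)
      then show ?thesis by (simp add: linear_add[OF l(1)] linear_scale[OF l(1)])
    qed
    show "f (a *\<^sub>C x) = a *\<^sub>C f x"
      using sc[of a] sc[of "\<i> * a"]
      by (simp add: f_def complex_eq_iff scaleC_complex_def scaleC_scaleC algebra_simps)
  qed
  have Ref: "Re (f x) = l x" for x by (simp add: f_def)
  \<comment> \<open>Rotating \<open>x\<close> makes \<open>f x\<close> real and nonnegative, so the bound on the real part suffices.\<close>
  have bd: "norm (f x) \<le> 1 * norm x" for x
  proof -
    obtain a where a: "cmod a = 1" "a * f x = of_real (cmod (f x))"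
      using complex_rotation by blast
    then have "cmod (f x) = Re (f (a *\<^sub>C x))"
      using clinear_on_simps(2)[OF cl, of a x] by (simp add: scaleC_complex_def)
    also have "\<dots> \<le> norm (a *\<^sub>C x)" unfolding Ref by (rule l_le)
    finally show ?thesis using a by (simp add: norm_scaleC)
  qed
  note F = cblinfun_apply_CBlinfun[OF cl bd]
  have n1: "norm (CBlinfun f) \<le> 1"
    using norm_cblinfun_leI[of 1 "CBlinfun f"] bd unfolding F by simp
  have "cmod (f y) \<le> norm y" using bd[of y] by simp
  then have "(norm y)\<^sup>2 + (Im (f y))\<^sup>2 \<le> (norm y)\<^sup>2"
    using power_mono[of "cmod (f y)" "norm y" 2] by (simp add: cmod_power2 Ref ly)
  then have "f y = of_real (norm y)" by (simp add: complex_eq_iff Ref ly)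
  then show ?thesis using that n1 F by metis
qed

lemma cdual_separates:
  fixes x y :: "'a::complex_normed_vector"
  assumes "\<And>\<phi> :: 'a cdual. cblinfun_apply \<phi> x = cblinfun_apply \<phi> y"
  shows "x = y"
proof -
  obtain \<phi> :: "'a cdual" where "cblinfun_apply \<phi> (x - y) = of_real (norm (x - y))"
    using norming_functional by blast
  then show ?thesis using assms[of \<phi>] by (simp add: cblinfun_simps)
qed

section \<open>Weak and weak* topologies\<close>

lemma continuous_map_cblinfun_weak:
  "continuous_map weak_topology euclidean (cblinfun_apply (\<phi> :: 'a::complex_normed_vector cdual))"
proof -
  have "openin weak_topology (cblinfun_apply \<phi> -` U)" if "open U" for U
    unfolding weak_topology_def by (rule topology_generated_by_Basis) (use that in blast)
  then show ?thesis unfolding continuous_map_alt by (simp add: topspace_weak_topology)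
qed

lemma continuous_map_into_weak_iff:
  fixes g :: "'b \<Rightarrow> 'a::complex_normed_vector"
  shows "continuous_map X weak_topology g \<longleftrightarrow>
    (\<forall>\<phi> :: 'a cdual. continuous_map X euclidean (\<lambda>x. cblinfun_apply \<phi> (g x)))"
proof
  assume g: "continuous_map X weak_topology g"
  show "\<forall>\<phi> :: 'a cdual. continuous_map X euclidean (\<lambda>x. cblinfun_apply \<phi> (g x))"
    using continuous_map_compose[OF g continuous_map_cblinfun_weak] by (simp add: comp_def)
next
  assume R: "\<forall>\<phi> :: 'a cdual. continuous_map X euclidean (\<lambda>x. cblinfun_apply \<phi> (g x))"
  show "continuous_map X weak_topology g"
    unfolding weak_topology_def
  proof (rule continuous_on_generated_topo)
    fix B assume "B \<in> {cblinfun_apply \<phi> -` U | (\<phi> :: 'a cdual) U. open U}"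
    then obtain \<phi> :: "'a cdual" and U where B: "B = cblinfun_apply \<phi> -` U" "open U" by blast
    have "openin X ((\<lambda>x. cblinfun_apply \<phi> (g x)) -` U \<inter> topspace X)"
      using R B(2) unfolding continuous_map_alt by auto
    then show "openin X (g -` B \<inter> topspace X)" by (simp add: B(1) vimage_def)
  next
    show "g ` topspace X \<subseteq> \<Union> {cblinfun_apply \<phi> -` U | (\<phi> :: 'a cdual) U. open U}"
      using topspace_weak_topology[where 'a = 'a]
      unfolding weak_topology_def topology_generated_by_topspace by auto
  qed
qed

lemma Hausdorff_weak_topology: "Hausdorff_space (weak_topology :: 'a::complex_normed_vector topology)"
  unfolding Hausdorff_space_def topspace_weak_topology
proof (intro allI impI)
  fix x y :: 'a assume "x \<in> UNIV \<and> y \<in> UNIV \<and> x \<noteq> y"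
  then obtain \<phi> :: "'a cdual" where "cblinfun_apply \<phi> x \<noteq> cblinfun_apply \<phi> y"
    using cdual_separates by blast
  from hausdorff[OF this] obtain U V where UV: "open U" "open V" "cblinfun_apply \<phi> x \<in> U"
    "cblinfun_apply \<phi> y \<in> V" "U \<inter> V = {}" by blast
  have "openin weak_topology (cblinfun_apply \<phi> -` W)" if "open W" for W
    unfolding weak_topology_def by (rule topology_generated_by_Basis) (use that in blast)
  then show "\<exists>U V. openin weak_topology U \<and> openin weak_topology V \<and> x \<in> U \<and> y \<in> V \<and> disjnt U V"
    using UV by (intro exI[of _ "cblinfun_apply \<phi> -` U"] exI[of _ "cblinfun_apply \<phi> -` V"])
      (auto simp: disjnt_def)
qed

lemma topspace_weak_star_topology: "topspace weak_star_topology = UNIV"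
proof -
  have "(\<lambda>\<phi>. cblinfun_apply \<phi> 0) -` UNIV \<in> {(\<lambda>\<phi> :: 'a cdual. cblinfun_apply \<phi> y) -` U | y U. open U}"
    by blast
  then show ?thesis unfolding weak_star_topology_def topology_generated_by_topspace by blast
qed

lemma continuous_map_evaluation_weak_star:
  "continuous_map weak_star_topology euclidean
    (\<lambda>\<phi> :: 'a::complex_normed_vector cdual. cblinfun_apply \<phi> y)"
proof -
  have "openin weak_star_topology ((\<lambda>\<phi> :: 'a cdual. cblinfun_apply \<phi> y) -` U)" if "open U" for U
    unfolding weak_star_topology_def by (rule topology_generated_by_Basis) (use that in blast)
  then show ?thesis unfolding continuous_map_alt by (simp add: topspace_weak_star_topology)
qed

lemma openin_weak_star_finite:
  fixes U :: "'a::complex_normed_vector cdual set"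
  assumes "openin weak_star_topology U" "\<phi> \<in> U"
  shows "\<exists>A. finite A \<and> (\<forall>\<psi>. (\<forall>y\<in>A. cblinfun_apply \<psi> y = cblinfun_apply \<phi> y) \<longrightarrow> \<psi> \<in> U)"
proof -
  have "generate_topology_on {(\<lambda>\<phi> :: 'a cdual. cblinfun_apply \<phi> y) -` U | y U. open U} U"
    using assms(1) unfolding weak_star_topology_def by (rule openin_topology_generated_by)
  then show ?thesis
    using assms(2)
  proof (induction arbitrary: \<phi>)
    case (Int a b)
    then have "\<phi> \<in> a" "\<phi> \<in> b" by simp_all
    from Int.IH(1)[OF this(1)] obtain A where A: "finite A"
      "\<And>\<psi>. \<forall>y\<in>A. cblinfun_apply \<psi> y = cblinfun_apply \<phi> y \<Longrightarrow> \<psi> \<in> a" by blast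
    from Int.IH(2)[OF \<open>\<phi> \<in> b\<close>] obtain B where B: "finite B"
      "\<And>\<psi>. \<forall>y\<in>B. cblinfun_apply \<psi> y = cblinfun_apply \<phi> y \<Longrightarrow> \<psi> \<in> b" by blast
    show ?case by (rule exI[of _ "A \<union> B"]) (use A B in simp)
  next
    case (UN K)
    from UN.prems obtain k where "k \<in> K" "\<phi> \<in> k" by blast
    with UN.IH[OF this] show ?case by blast
  next
    case (Basis s)
    then obtain y V where "s = (\<lambda>\<phi> :: 'a cdual. cblinfun_apply \<phi> y) -` V" by blast
    then show ?case using Basis.prems by (intro exI[of _ "{y}"]) auto
  qed simp
qed

text \<open>Induction on the finite set: a functional vanishing wherever the evaluations at \<open>A\<close> and at \<open>z\<close>
  vanish becomes, after subtraction of a multiple of the evaluation at \<open>z\<close>, one that vanishes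
  wherever those at \<open>A\<close> do.\<close>

lemma functional_on_finite_codimension:
  fixes g :: "'a::complex_normed_vector cdual \<Rightarrow> complex"
  assumes "finite A" "clinear_on UNIV g"
    and "\<And>\<phi>. (\<forall>y\<in>A. cblinfun_apply \<phi> y = 0) \<Longrightarrow> g \<phi> = 0"
  shows "\<exists>y. \<forall>\<phi>. g \<phi> = cblinfun_apply \<phi> y"
  using assms
proof (induction A arbitrary: g rule: finite_induct)
  case empty
  then show ?case by (intro exI[of _ 0]) (simp add: cblinfun_0)
next
  case (insert z A)
  note gl = clinear_on_simps[OF insert.prems(1)]
  show ?case
  proof (cases "\<exists>\<eta> :: 'a cdual. (\<forall>y\<in>A. cblinfun_apply \<eta> y = 0) \<and> cblinfun_apply \<eta> z \<noteq> 0")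
    case False
    show ?thesis
    proof (rule insert.IH[OF insert.prems(1)])
      fix \<phi> :: "'a cdual" assume "\<forall>y\<in>A. cblinfun_apply \<phi> y = 0"
      then show "g \<phi> = 0" using False insert.prems(2)[of \<phi>] by blast
    qed
  next
    case True
    then obtain \<eta> :: "'a cdual" where \<eta>: "\<And>y. y \<in> A \<Longrightarrow> cblinfun_apply \<eta> y = 0" "cblinfun_apply \<eta> z \<noteq> 0" by blast
    define c where "c = g \<eta> / cblinfun_apply \<eta> z"
    \<comment> \<open>The subtracted multiple makes the new functional vanish at \<open>\<eta>\<close> as well.\<close>
    have "\<exists>y. \<forall>\<phi>. g \<phi> - c * cblinfun_apply \<phi> z = cblinfun_apply \<phi> y"
    proof (rule insert.IH)
      show "clinear_on UNIV (\<lambda>\<phi>. g \<phi> - c * cblinfun_apply \<phi> z)"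
        by (simp add: clinear_on_def gl cblinfun_ops scaleC_complex_def algebra_simps)
      fix \<phi> :: "'a cdual" assume \<phi>: "\<forall>y\<in>A. cblinfun_apply \<phi> y = 0"
      \<comment> \<open>Correcting \<open>\<phi>\<close> by a multiple of \<open>\<eta>\<close> makes its value at \<open>z\<close> vanish too.\<close>
      define b where "b = cblinfun_apply \<phi> z / cblinfun_apply \<eta> z"
      have "g (\<phi> - b *\<^sub>C \<eta>) = 0"
        by (rule insert.prems(2)) (use \<phi> \<eta> in \<open>auto simp: cblinfun_ops scaleC_complex_def b_def\<close>)
      then show "g \<phi> - c * cblinfun_apply \<phi> z = 0"
        using \<eta>(2) by (simp add: gl scaleC_complex_def b_def c_def)
    qed
    then obtain y where y: "\<And>\<phi>. g \<phi> - c * cblinfun_apply \<phi> z = cblinfun_apply \<phi> y" by blast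
    have "g \<phi> = cblinfun_apply \<phi> (y + c *\<^sub>C z)" for \<phi>
      using y[of \<phi>] by (simp add: cblinfun_simps scaleC_complex_def algebra_simps)
    then show ?thesis by blast
  qed
qed

text \<open>The dual of the weak* topology is the original space: a weak* continuous functional is bounded
  by \<open>1\<close>, hence by linearity zero, wherever finitely many evaluations vanish.\<close>

lemma weak_star_continuous_imp_evaluation:
  fixes g :: "'a::complex_normed_vector cdual \<Rightarrow> complex"
  assumes lin: "clinear_on UNIV g" and cont: "continuous_map weak_star_topology euclidean g"
  shows "\<exists>y. \<forall>\<phi>. g \<phi> = cblinfun_apply \<phi> y"
proof -
  note gl = clinear_on_simps[OF lin]
  have "openin weak_star_topology (g -` ball 0 1)"
    using cont unfolding continuous_map_alt by (simp add: topspace_weak_star_topology)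
  moreover have "0 \<in> g -` ball 0 1" by (simp add: gl)
  ultimately obtain A where A: "finite A"
    "\<And>\<psi>. (\<forall>y\<in>A. cblinfun_apply \<psi> y = cblinfun_apply 0 y) \<Longrightarrow> \<psi> \<in> g -` ball 0 1"
    using openin_weak_star_finite by meson
  show ?thesis
  proof (rule functional_on_finite_codimension[OF A(1) lin], rule ccontr)
    fix \<phi> :: "'a cdual" assume \<phi>: "\<forall>y\<in>A. cblinfun_apply \<phi> y = 0" and nz: "g \<phi> \<noteq> 0"
    \<comment> \<open>The multiple of \<open>\<phi>\<close> on which \<open>g\<close> takes the value \<open>1\<close> still vanishes on \<open>A\<close>.\<close>
    have "inverse (g \<phi>) *\<^sub>C \<phi> \<in> g -` ball 0 1"
      by (rule A(2)) (use \<phi> in \<open>simp add: cblinfun_ops scaleC_complex_def\<close>)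
    then show False using nz by (simp add: gl scaleC_complex_def)
  qed
qed

lemma weak_star_weak_operators_iff:
  fixes T :: "'y::complex_normed_vector cdual \<Rightarrow> 'z::complex_normed_vector"
  shows "T \<in> weak_star_weak_operators \<longleftrightarrow> clinear_on UNIV T \<and>
    (\<forall>F :: 'z cdual. \<exists>y. \<forall>\<phi>. cblinfun_apply F (T \<phi>) = cblinfun_apply \<phi> y)"
proof -
  have "\<exists>y. \<forall>\<phi>. cblinfun_apply F (T \<phi>) = cblinfun_apply \<phi> y"
    if "clinear_on UNIV T" "continuous_map weak_star_topology weak_topology T" for F :: "'z cdual"
  proof (rule weak_star_continuous_imp_evaluation)
    show "clinear_on UNIV (\<lambda>\<phi>. cblinfun_apply F (T \<phi>))"
      by (simp add: clinear_on_def clinear_on_simps[OF that(1)] cblinfun_simps)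
    show "continuous_map weak_star_topology euclidean (\<lambda>\<phi>. cblinfun_apply F (T \<phi>))"
      using that(2) by (simp add: continuous_map_into_weak_iff)
  qed
  moreover have "continuous_map weak_star_topology weak_topology T"
    if rep: "\<forall>F :: 'z cdual. \<exists>y. \<forall>\<phi>. cblinfun_apply F (T \<phi>) = cblinfun_apply \<phi> y"
    unfolding continuous_map_into_weak_iff
  proof
    fix F :: "'z cdual"
    obtain y where "\<And>\<phi>. cblinfun_apply F (T \<phi>) = cblinfun_apply \<phi> y" using rep by blast
    then show "continuous_map weak_star_topology euclidean (\<lambda>\<phi>. cblinfun_apply F (T \<phi>))"
      by (simp add: continuous_map_evaluation_weak_star)
  qed
  ultimately show ?thesis unfolding weak_star_weak_operators_def by blast
qed

section \<open>Functionals dominated by a weakly compact set\<close>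

lemma cblinfun_apply_sum:
  "cblinfun_apply (\<Sum>i\<in>I. \<psi> i) x = (\<Sum>i\<in>I. cblinfun_apply (\<psi> i) x)"
  by (induction I rule: infinite_finite_induct) (simp_all add: cblinfun_ops)

lemma continuous_map_weak_affine:
  "continuous_map weak_topology weak_topology (\<lambda>x::'a::complex_normed_vector. a *\<^sub>C x + b)"
  unfolding continuous_map_into_weak_iff
proof
  fix \<phi> :: "'a cdual"
  have "cblinfun_apply \<phi> (a *\<^sub>C x + b) = cblinfun_apply (a *\<^sub>C \<phi>) x + cblinfun_apply \<phi> b" for x
    by (simp add: cblinfun_simps scaleC_cblinfun.rep_eq)
  then show "continuous_map weak_topology euclidean (\<lambda>x. cblinfun_apply \<phi> (a *\<^sub>C x + b))"
    using continuous_map_add[OF continuous_map_cblinfun_weak[of "a *\<^sub>C \<phi>"]] by simp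
qed

definition abs_convex :: "'a::complex_vector set \<Rightarrow> bool"
  where "abs_convex D \<longleftrightarrow>
    (\<forall>x\<in>D. \<forall>y\<in>D. \<forall>a b. cmod a + cmod b \<le> 1 \<longrightarrow> a *\<^sub>C x + b *\<^sub>C y \<in> D)"

text \<open>Affine maps are weakly continuous, so they carry the closure of \<open>D\<close> into the closure of their
  image of \<open>D\<close>.\<close>

lemma abs_convex_weak_closure:
  fixes D :: "'a::complex_normed_vector set"
  assumes "abs_convex D"
  shows "abs_convex (weak_topology closure_of D)"
proof -
  let ?K = "weak_topology closure_of D"
  have DK: "D \<subseteq> ?K" by (rule closure_of_subset) (simp add: topspace_weak_topology)
  have cl: "f x \<in> ?K" if "f ` D \<subseteq> ?K" "x \<in> ?K" "continuous_map weak_topology weak_topology f" for f x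
  proof -
    have "f x \<in> weak_topology closure_of (f ` D)"
      using continuous_map_image_closure_subset[OF that(3), of D] that(2) by blast
    then show ?thesis using closure_of_minimal[OF that(1) closedin_closure_of] by blast
  qed
  \<comment> \<open>One variable at a time: first \<open>y\<close> moves from \<open>D\<close> to its closure, then \<open>x\<close>.\<close>
  have 1: "a *\<^sub>C x + b *\<^sub>C y \<in> ?K" if "x \<in> D" "y \<in> ?K" "cmod a + cmod b \<le> 1" for a b x y
  proof -
    have "b *\<^sub>C y + a *\<^sub>C x \<in> ?K"
    proof (rule cl[OF _ that(2) continuous_map_weak_affine])
      show "(\<lambda>y. b *\<^sub>C y + a *\<^sub>C x) ` D \<subseteq> ?K"
        using assms that(1,3) DK by (auto simp: abs_convex_def add.commute)
    qed
    then show ?thesis by (simp add: add.commute)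
  qed
  show ?thesis
    unfolding abs_convex_def
  proof (intro ballI allI impI)
    fix x y a b assume that: "x \<in> ?K" "y \<in> ?K" "cmod a + cmod b \<le> 1"
    show "a *\<^sub>C x + b *\<^sub>C y \<in> ?K"
      by (rule cl[OF _ that(1) continuous_map_weak_affine]) (use 1 that(2,3) in blast)
  qed
qed

text \<open>The finite-dimensional core: the point of \<open>K\<close> nearest to the prescribed values in the Euclidean
  distance attains them. Let \<open>c \<phi> = g \<phi> - \<phi> p\<close> be the residuals at the minimiser \<open>p\<close> and
  \<open>\<psi>\<close> the combination of the \<open>\<phi>\<close> with coefficients \<open>cnj (c \<phi>)\<close>. Minimality on a convex and
  balanced set makes \<open>Re (\<psi> p)\<close> the maximum of \<open>\<bar>\<psi>\<bar>\<close> on \<open>K\<close>, so \<open>Re (g \<psi>) \<le> Re (\<psi> p)\<close>; but the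
  difference \<open>Re (g \<psi>) - Re (\<psi> p)\<close> is the sum of the \<open>\<bar>c \<phi>\<bar>\<^sup>2\<close>.\<close>

lemma dominated_functional_finite:
  fixes g :: "'y::complex_normed_vector cdual \<Rightarrow> complex"
  assumes K: "compactin weak_topology K" "K \<noteq> {}" "abs_convex K"
    and lin: "clinear_on UNIV g"
    and dom: "\<And>\<phi> r. (\<And>d. d \<in> K \<Longrightarrow> cmod (cblinfun_apply \<phi> d) \<le> r) \<Longrightarrow> cmod (g \<phi>) \<le> r"
    and fin: "finite \<Phi>"
  shows "\<exists>p\<in>K. \<forall>\<phi>\<in>\<Phi>. cblinfun_apply \<phi> p = g \<phi>"
proof -
  define q where "q d = (\<Sum>\<phi>\<in>\<Phi>. (cmod (cblinfun_apply \<phi> d - g \<phi>))\<^sup>2)" for d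
  have "continuous_map weak_topology euclidean q"
    unfolding q_def
    by (intro continuous_map_sum fin continuous_map_real_pow continuous_map_norm continuous_map_diff
        continuous_map_cblinfun_weak) auto
  then have "compact (q ` K)" using image_compactin[OF K(1), of euclidean q] by simp
  then obtain p where p: "p \<in> K" and pmin: "\<And>d. d \<in> K \<Longrightarrow> q p \<le> q d"
    using compact_attains_inf[of "q ` K"] K(2) by auto
  define c where "c \<phi> = g \<phi> - cblinfun_apply \<phi> p" for \<phi>
  define \<psi> where "\<psi> = (\<Sum>\<phi>\<in>\<Phi>. cnj (c \<phi>) *\<^sub>C \<phi>)"
  have \<psi>: "cblinfun_apply \<psi> x = (\<Sum>\<phi>\<in>\<Phi>. cnj (c \<phi>) * cblinfun_apply \<phi> x)" for x
    by (simp add: \<psi>_def cblinfun_apply_sum scaleC_cblinfun.rep_eq scaleC_complex_def)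
  have Re_le: "Re (cblinfun_apply \<psi> d) \<le> Re (cblinfun_apply \<psi> p)" if d: "d \<in> K" for d
  proof -
    define A where "A = Re (cblinfun_apply \<psi> (d - p))"
    define M where "M = (\<Sum>\<phi>\<in>\<Phi>. (cmod (cblinfun_apply \<phi> (d - p)))\<^sup>2)"
    \<comment> \<open>Compare the minimum with the values on the segment from \<open>p\<close> to \<open>d\<close>, and let \<open>t\<close> tend to \<open>0\<close>.\<close>
    have *: "2 * A \<le> t * M" if t: "0 < t" "t \<le> 1" for t :: real
    proof -
      let ?d = "of_real (1 - t) *\<^sub>C p + of_real t *\<^sub>C d"
      have "cmod (of_real (1 - t)) + cmod (of_real t) \<le> 1" using t by (simp only: norm_of_real)
      then have "?d \<in> K" using K(3) p d by (simp only: abs_convex_def)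
      have sq: "(cmod (cblinfun_apply \<phi> ?d - g \<phi>))\<^sup>2 = (cmod (cblinfun_apply \<phi> p - g \<phi>))\<^sup>2
          - 2 * t * Re (cnj (c \<phi>) * cblinfun_apply \<phi> (d - p)) + t\<^sup>2 * (cmod (cblinfun_apply \<phi> (d - p)))\<^sup>2"
        for \<phi>
        unfolding c_def cblinfun_simps scaleC_complex_def cmod_power2
        by (simp add: power2_eq_square algebra_simps)
      have "q ?d = q p - 2 * t * A + t\<^sup>2 * M"
        unfolding q_def A_def M_def \<psi> sq
        by (simp only: sum.distrib sum_subtractf sum_distrib_left Re_sum)
      with pmin[OF \<open>?d \<in> K\<close>] have "t * (2 * A) \<le> t * (t * M)" by (simp add: power2_eq_square)
      then show ?thesis using t by simp
    qed
    have "A \<le> 0"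
    proof (rule ccontr)
      assume "\<not> A \<le> 0"
      then have A: "A > 0" by simp
      have "M > 0" using *[of 1] A by simp
      have "2 * A \<le> min 1 (A / M) * M" by (rule *) (use A \<open>M > 0\<close> in auto)
      also have "\<dots> \<le> A / M * M" by (rule mult_right_mono) (use \<open>M > 0\<close> in auto)
      finally show False using A \<open>M > 0\<close> by simp
    qed
    then show ?thesis by (simp add: A_def cblinfun_diff)
  qed
  have "cmod (g \<psi>) \<le> Re (cblinfun_apply \<psi> p)"
  proof (rule dom)
    fix d assume d: "d \<in> K"
    obtain a where a: "cmod a = 1" "a * cblinfun_apply \<psi> d = of_real (cmod (cblinfun_apply \<psi> d))"
      using complex_rotation by blast
    have "a *\<^sub>C d \<in> K"
    proof -
      have "a *\<^sub>C d + 0 *\<^sub>C d \<in> K" using K(3) d a(1) by (simp add: abs_convex_def del: complex_vector.scale_zero_left)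
      then show ?thesis by simp
    qed
    from Re_le[OF this] a(2) show "cmod (cblinfun_apply \<psi> d) \<le> Re (cblinfun_apply \<psi> p)"
      by (simp add: cblinfun_scaleC scaleC_complex_def)
  qed
  then have "Re (g \<psi>) \<le> Re (cblinfun_apply \<psi> p)" using complex_Re_le_cmod order_trans by blast
  moreover have "g (\<Sum>\<phi>\<in>\<Psi>. cnj (c \<phi>) *\<^sub>C \<phi>) = (\<Sum>\<phi>\<in>\<Psi>. cnj (c \<phi>) * g \<phi>)" for \<Psi>
    by (induction \<Psi> rule: infinite_finite_induct)
      (simp_all add: clinear_on_simps[OF lin] scaleC_complex_def)
  then have "Re (g \<psi>) - Re (cblinfun_apply \<psi> p) = (\<Sum>\<phi>\<in>\<Phi>. (cmod (c \<phi>))\<^sup>2)"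
    unfolding \<psi> by (simp add: \<psi>_def c_def sum_subtractf[symmetric] cmod_power2)
      (simp add: power2_eq_square algebra_simps)
  ultimately have "(\<Sum>\<phi>\<in>\<Phi>. (cmod (c \<phi>))\<^sup>2) = 0" by (intro antisym sum_nonneg) auto
  then have "\<forall>\<phi>\<in>\<Phi>. c \<phi> = 0" using fin by (simp add: sum_nonneg_eq_0_iff)
  then show ?thesis using p by (auto simp: c_def)
qed

text \<open>The core of the Mackey--Arens theorem. Each finite set of functionals has a solution in the weak
  closure of \<open>D\<close>; the finite intersection property for the weakly closed sets of solutions glues them.\<close>

lemma dominated_functional_represented:
  fixes g :: "'y::complex_normed_vector cdual \<Rightarrow> complex"
  assumes D: "relatively_weakly_compact D" "D \<noteq> {}" "abs_convex D"
    and lin: "clinear_on UNIV g"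
    and dom: "\<And>\<phi> r. (\<And>d. d \<in> D \<Longrightarrow> cmod (cblinfun_apply \<phi> d) \<le> r) \<Longrightarrow> cmod (g \<phi>) \<le> r"
  shows "\<exists>y. \<forall>\<phi>. g \<phi> = cblinfun_apply \<phi> y"
proof -
  let ?K = "weak_topology closure_of D"
  have DK: "D \<subseteq> ?K" by (rule closure_of_subset) (simp add: topspace_weak_topology)
  have K: "compactin weak_topology ?K" using D(1) by (simp add: relatively_weakly_compact_def)
  have ex: "\<exists>p\<in>?K. \<forall>\<phi>\<in>\<Phi>. cblinfun_apply \<phi> p = g \<phi>" if "finite \<Phi>" for \<Phi>
    by (rule dominated_functional_finite[OF K _ abs_convex_weak_closure[OF D(3)] lin _ that])
      (use DK D(2) dom in blast)+
  define C where "C \<phi> = {d. cblinfun_apply \<phi> d = g \<phi>}" for \<phi>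
  have "?K \<inter> \<Inter>(range C) \<noteq> {}"
  proof -
    have "closedin weak_topology (C \<phi>)" for \<phi>
    proof -
      have "closedin weak_topology {x \<in> topspace weak_topology. cblinfun_apply \<phi> x \<in> {g \<phi>}}"
        by (rule closedin_continuous_map_preimage[OF continuous_map_cblinfun_weak]) simp
      then show ?thesis by (simp add: C_def topspace_weak_topology)
    qed
    moreover have "?K \<inter> \<Inter>\<F> \<noteq> {}" if F: "finite \<F>" "\<F> \<subseteq> range C" for \<F>
    proof -
      obtain \<Phi> where "finite \<Phi>" "\<F> = C ` \<Phi>" using finite_subset_image[OF F] by blast
      then show ?thesis using ex[of \<Phi>] by (auto simp: C_def)
    qed
    ultimately show ?thesis using K unfolding compactin_fip by blast
  qed
  then show ?thesis by (auto simp: C_def) metis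
qed

section \<open>Uniform boundedness\<close>

text \<open>A gliding hump: a sequence of functionals moves by at most \<open>(1/3)\<^sup>n\<close> in step \<open>n\<close>, to a
  functional whose value at \<open>m n\<close> is at least \<open>(1/3)\<^sup>n * norm (m n)\<close>; all later steps together move by
  at most \<open>(1/3)\<^sup>n / 2\<close> and so destroy at most half of this value. Since \<open>norm (m n)\<close> exceeds \<open>6\<^sup>n\<close>, the
  limit is unbounded on the \<open>m n\<close>.\<close>

lemma weakly_bounded_imp_bounded:
  fixes M :: "'a::complex_normed_vector set"
  assumes wb: "\<And>\<phi> :: 'a cdual. \<exists>b. \<forall>m\<in>M. cmod (cblinfun_apply \<phi> m) \<le> b"
  shows "\<exists>b. \<forall>m\<in>M. norm m \<le> b"
proof (rule ccontr)
  assume "\<not> ?thesis"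
  then have "\<forall>n. \<exists>m\<in>M. norm m > 6 ^ n" by (meson not_le)
  then obtain m where m: "\<And>n. m n \<in> M" "\<And>n. norm (m n) > 6 ^ n" by metis
  have step: "\<exists>\<delta> :: 'a cdual. norm \<delta> \<le> r \<and> cmod (cblinfun_apply (\<phi> + \<delta>) y) \<ge> r * norm y"
    if r: "r > 0" for r y and \<phi> :: "'a cdual"
  proof -
    obtain \<eta> :: "'a cdual" where \<eta>: "norm \<eta> \<le> 1" "cblinfun_apply \<eta> y = of_real (norm y)"
      using norming_functional by blast
    have n: "norm (of_real r *\<^sub>C \<eta>) \<le> r" "norm (of_real (- r) *\<^sub>C \<eta>) \<le> r"
      using \<eta>(1) r by (simp_all add: norm_scaleC mult_left_le)
    let ?u = "cblinfun_apply \<phi> y" and ?v = "of_real (r * norm y) :: complex"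
    \<comment> \<open>The values of \<open>\<phi> + r \<eta>\<close> and \<open>\<phi> - r \<eta>\<close> at \<open>y\<close> differ by \<open>2 * r * norm y\<close>: one of them is large.\<close>
    have "2 * (r * norm y) = cmod ((?u + ?v) - (?u - ?v))"
      using r by (simp add: norm_mult flip: of_real_mult)
    also have "\<dots> \<le> cmod (?u + ?v) + cmod (?u - ?v)" by (rule norm_triangle_ineq4)
    finally have "cmod (?u + ?v) \<ge> r * norm y \<or> cmod (?u - ?v) \<ge> r * norm y" by linarith
    moreover have "cblinfun_apply (\<phi> + of_real r *\<^sub>C \<eta>) y = ?u + ?v"
      "cblinfun_apply (\<phi> + of_real (- r) *\<^sub>C \<eta>) y = ?u - ?v"
      by (simp_all add: cblinfun_ops scaleC_complex_def \<eta>(2))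
    ultimately show ?thesis using n by metis
  qed
  have "\<forall>\<phi> n. \<exists>\<delta> :: 'a cdual. norm \<delta> \<le> (1 / 3) ^ n \<and>
      cmod (cblinfun_apply (\<phi> + \<delta>) (m n)) \<ge> (1 / 3) ^ n * norm (m n)"
    by (intro allI step) simp
  then obtain \<delta> :: "'a cdual \<Rightarrow> nat \<Rightarrow> 'a cdual" where \<delta>: "\<And>\<phi> n. norm (\<delta> \<phi> n) \<le> (1 / 3) ^ n"
    "\<And>\<phi> n. cmod (cblinfun_apply (\<phi> + \<delta> \<phi> n) (m n)) \<ge> (1 / 3) ^ n * norm (m n)"
    by metis
  define s where "s = rec_nat 0 (\<lambda>n \<phi>. \<phi> + \<delta> \<phi> n)"
  define d where "d n = \<delta> (s n) n" for n
  have s_Suc: "s (Suc n) = s n + d n" for n by (simp add: s_def d_def)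
  have s_sum: "s n = sum d {..<n}" for n by (induction n) (simp_all add: s_Suc, simp add: s_def)
  have geo: "summable (\<lambda>k. (1 / 3 :: real) ^ k)" by (rule summable_geometric) simp
  have dn: "norm (d n) \<le> (1 / 3) ^ n" for n unfolding d_def by (rule \<delta>(1))
  have sumn: "summable (\<lambda>n. norm (d n))" by (rule summable_comparison_test'[OF geo]) (simp add: dn)
  note sumd = summable_norm_cancel[OF sumn]
  define \<phi> where "\<phi> = suminf d"
  have tail: "norm (\<phi> - s (Suc n)) \<le> (1 / 3) ^ n / 2" for n
  proof -
    have "\<phi> - s (Suc n) = (\<Sum>k. d (k + Suc n))"
      unfolding \<phi>_def s_sum by (rule suminf_minus_initial_segment[OF sumd, symmetric])
    also have "norm \<dots> \<le> (\<Sum>k. norm (d (k + Suc n)))"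
      by (rule summable_norm[OF summable_ignore_initial_segment[OF sumn]])
    also have "\<dots> \<le> (\<Sum>k. (1 / 3) ^ k * (1 / 3) ^ Suc n)"
    proof (rule suminf_le)
      show "norm (d (k + Suc n)) \<le> (1 / 3) ^ k * (1 / 3) ^ Suc n" for k
        using dn[of "k + Suc n"] by (simp only: power_add)
      show "summable (\<lambda>k. norm (d (k + Suc n)))" by (rule summable_ignore_initial_segment[OF sumn])
      show "summable (\<lambda>k. (1 / 3 :: real) ^ k * (1 / 3) ^ Suc n)" by (rule summable_mult2[OF geo])
    qed
    also have "\<dots> = (1 / 3) ^ n / 2"
      using suminf_mult2[OF geo, of "(1 / 3) ^ Suc n"] suminf_geometric[of "1 / 3 :: real"] by simp
    finally show ?thesis .
  qed
  obtain b where b: "\<And>n. cmod (cblinfun_apply \<phi> (m n)) \<le> b" using wb[of \<phi>] m(1) by blast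
  have "2 ^ n \<le> 2 * b" for n
  proof -
    let ?u = "cblinfun_apply (s (Suc n)) (m n)"
    have "(1 / 3) ^ n * norm (m n) \<le> cmod ?u"
      unfolding s_Suc d_def by (rule \<delta>(2))
    also have "?u = cblinfun_apply \<phi> (m n) - cblinfun_apply (\<phi> - s (Suc n)) (m n)"
      by (simp add: minus_cblinfun.rep_eq)
    also have "cmod \<dots> \<le> b + (1 / 3) ^ n / 2 * norm (m n)"
      using norm_triangle_ineq4[of "cblinfun_apply \<phi> (m n)" "cblinfun_apply (\<phi> - s (Suc n)) (m n)"]
        b[of n] norm_cblinfun_le[of "\<phi> - s (Suc n)" "m n"]
        mult_right_mono[OF tail[of n], of "norm (m n)"] by simp
    finally have "(1 / 3) ^ n * norm (m n) \<le> 2 * b" by simp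
    moreover have "(1 / 3) ^ n * 6 ^ n \<le> (1 / 3) ^ n * norm (m n)"
      using m(2)[of n] by (intro mult_left_mono) auto
    moreover have "(1 / 3) ^ n * 6 ^ n = (2 :: real) ^ n"
      unfolding power_mult_distrib[symmetric] by simp
    ultimately show ?thesis by linarith
  qed
  then show False using real_arch_pow[of 2 "2 * b"] by (meson not_le one_less_numeral_iff semiring_norm(76))
qed

section \<open>Weak compactness of the image of a dual ball\<close>

text \<open>Banach--Alaoglu: the unit ball of \<open>Z\<^sup>*\<close>, embedded by its values in a product of compact discs, is
  cut out by closed linearity conditions. A map \<open>S\<close> with adjoint \<open>T\<close> is continuous from the
  pointwise to the weak topology.\<close>

lemma weakly_compact_image_dual_ball:
  fixes T :: "'y::complex_normed_vector cdual \<Rightarrow> 'z::complex_normed_vector" and S :: "'z cdual \<Rightarrow> 'y"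
  assumes adj: "\<And>F \<phi>. cblinfun_apply \<phi> (S F) = cblinfun_apply F (T \<phi>)"
  shows "compactin weak_topology (S ` cball 0 1)"
proof -
  define P :: "('z \<Rightarrow> complex) set" where "P = PiE UNIV (\<lambda>z. cball 0 (norm z))"
  define A where "A = P \<inter> {F. clinear_on UNIV F}"
  have "compact P"
    using compactin_PiE[of "\<lambda>_ :: 'z. euclidean :: complex topology" UNIV "\<lambda>z. cball 0 (norm z)"]
    by (simp add: P_def euclidean_product_topology)
  moreover have "closed {F :: 'z \<Rightarrow> complex. clinear_on UNIV F}"
    unfolding clinear_on_def scaleC_complex_def
    by (simp, intro closed_Collect_conj closed_Collect_all closed_Collect_eq continuous_intros)
      (auto intro: continuous_on_product_coordinates continuous_intros)
  ultimately have "compact A" unfolding A_def by (rule compact_Int_closed)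
  then have cA: "compactin (subtopology euclidean A) A" by (simp add: compactin_subtopology)
  have bd: "cmod (F z) \<le> 1 * norm z" if "F \<in> A" for F z using that by (auto simp: A_def P_def)
  have ap: "cblinfun_apply (CBlinfun F) = F" if "F \<in> A" for F
    by (rule cblinfun_apply_CBlinfun[OF _ bd[OF that]]) (use that in \<open>simp add: A_def\<close>)
  have ran: "CBlinfun ` A = cball 0 1"
  proof (intro equalityI subsetI)
    fix F assume "F \<in> CBlinfun ` A"
    then obtain G where G: "G \<in> A" "F = CBlinfun G" by blast
    then have "norm F \<le> 1" using bd[OF G(1)] by (intro norm_cblinfun_leI) (simp_all add: ap)
    then show "F \<in> cball 0 1" by simp
  next
    fix F :: "'z cdual" assume F: "F \<in> cball 0 1"
    have "cmod (cblinfun_apply F z) \<le> norm z" for z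
      using norm_cblinfun_le[of F z] mult_right_mono[of "norm F" 1 "norm z"] F by simp
    then have "cblinfun_apply F \<in> A" by (simp add: A_def P_def PiE_iff cblinfun_clinear)
    then show "F \<in> CBlinfun ` A" by (metis cblinfun_apply_inverse image_eqI)
  qed
  have "continuous_map (subtopology euclidean A) weak_topology (\<lambda>F. S (CBlinfun F))"
    unfolding continuous_map_into_weak_iff
  proof
    fix \<phi> :: "'y cdual"
    have "continuous_map (subtopology euclidean A) euclidean (\<lambda>F. F (T \<phi>))"
      using continuous_on_subset[OF continuous_on_product_coordinates, of A "T \<phi>"] by simp
    then show "continuous_map (subtopology euclidean A) euclidean (\<lambda>F. cblinfun_apply \<phi> (S (CBlinfun F)))"
      by (rule continuous_map_eq) (simp add: adj ap)
  qed
  from image_compactin[OF cA this] show ?thesis by (simp add: image_image[symmetric] ran)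
qed

section \<open>Holomorphic Lipschitz functions along complex lines\<close>

lemma hlip0_eqI: "(\<And>x. hlip0_apply f x = hlip0_apply g x) \<Longrightarrow> f = g"
  by (simp add: hlip0_apply_inject[symmetric] fun_eq_iff)

lemma hlip0_ops:
  "hlip0_apply (f + g) x = hlip0_apply f x + hlip0_apply g x"
  "hlip0_apply (a *\<^sub>C f) x = a *\<^sub>C hlip0_apply f x"
  "hlip0_apply 0 x = 0"
  by (simp_all add: plus_hlip0.rep_eq scaleC_hlip0.rep_eq zero_hlip0.rep_eq)

lemma hlip0_at_0: "hlip0_apply f 0 = 0"
  using hlip0_apply[of f] by simp

lemma hlip0_outside: "x \<notin> ball 0 1 \<Longrightarrow> hlip0_apply f x = 0"
  using hlip0_apply[of f] by blast

lemma hlip0_lipschitz: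
  assumes "x \<in> ball 0 1" "y \<in> ball 0 1"
  shows "norm (hlip0_apply f x - hlip0_apply f y) \<le> norm f * norm (x - y)"
proof -
  obtain K where "K-lipschitz_on (ball 0 1) (hlip0_apply f)" using hlip0_apply[of f] by blast
  then show ?thesis unfolding norm_hlip0.rep_eq using assms by (rule lip_norm_bound)
qed

lemma norm_hlip0_leI:
  assumes "0 \<le> K"
    and "\<And>x y. x \<in> ball 0 1 \<Longrightarrow> y \<in> ball 0 1 \<Longrightarrow>
      norm (hlip0_apply f x - hlip0_apply f y) \<le> K * norm (x - y)"
  shows "norm f \<le> K"
  unfolding norm_hlip0.rep_eq using assms by (rule lip_norm_least)

lemma norm_hlip0_apply_le: "norm (hlip0_apply f x) \<le> norm x * norm f"
proof (cases "x \<in> ball 0 1")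
  case True
  then show ?thesis using hlip0_lipschitz[of x 0 f] by (simp add: hlip0_at_0 mult.commute)
qed (simp add: hlip0_outside)

lemma hlip0_derivative:
  fixes f :: "('a::complex_normed_vector, 'b::complex_normed_vector) hlip0"
  assumes "x \<in> ball 0 1"
  shows "\<exists>D :: ('a, 'b) cblinfun. (hlip0_apply f has_derivative cblinfun_apply D) (at x)"
  using hlip0_apply[of f] assms by (simp add: holomorphic_map_on_def)

lemma has_field_derivative_along_line:
  fixes g :: "'a::complex_normed_vector \<Rightarrow> complex" and D :: "'a cdual"
  assumes "(g has_derivative cblinfun_apply D) (at (a + \<zeta> *\<^sub>C h))"
  shows "((\<lambda>\<zeta>. g (a + \<zeta> *\<^sub>C h)) has_field_derivative cblinfun_apply D h) (at \<zeta>)"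
proof -
  have bl: "bounded_linear (\<lambda>\<zeta>. \<zeta> *\<^sub>C h)"
    by (rule bounded_linear_intro[where K = "norm h"])
      (simp_all add: scaleC_add_left scaleR_scaleC scaleC_complex_def scaleC_scaleC norm_scaleC)
  have "((\<lambda>\<zeta>. a + \<zeta> *\<^sub>C h) has_derivative (\<lambda>\<zeta>. \<zeta> *\<^sub>C h)) (at \<zeta>)"
    using has_derivative_add[OF has_derivative_const[of a] bounded_linear_imp_has_derivative[OF bl]]
    by simp
  from has_derivative_compose[OF this assms]
  show ?thesis
    unfolding has_field_derivative_def
    by (rule has_derivative_eq_rhs) (simp add: cblinfun_scaleC scaleC_complex_def mult.commute fun_eq_iff)
qed

text \<open>Cauchy's inequality, applied to \<open>u - u z\<close> on a circle of radius \<open>r\<close> about \<open>z\<close>, where a Lipschitz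
  function is bounded by \<open>K * r\<close>.\<close>

lemma lipschitz_Cauchy_inequality:
  fixes u :: "complex \<Rightarrow> complex"
  assumes hol: "u holomorphic_on ball 0 R"
    and lip: "\<And>z w. z \<in> ball 0 R \<Longrightarrow> w \<in> ball 0 R \<Longrightarrow> cmod (u z - u w) \<le> K * cmod (z - w)"
    and r: "0 < r" "cmod z + r < R" and n: "0 < n"
  shows "cmod ((deriv ^^ n) u z) \<le> fact n * (K * r) / r ^ n"
proof -
  have sub: "cball z r \<subseteq> ball 0 R"
  proof
    fix w assume "w \<in> cball z r"
    then show "w \<in> ball 0 R" using norm_triangle_ineq[of z "w - z"] r by (simp add: dist_norm norm_minus_commute)
  qed
  have zb: "z \<in> ball 0 R" using r by simp
  have hol': "(\<lambda>w. u w - u z) holomorphic_on ball 0 R" by (intro holomorphic_intros hol)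
  have "cmod ((deriv ^^ n) (\<lambda>w. u w - u z) z) \<le> fact n * (K * r) / r ^ n"
  proof (rule Cauchy_inequality[OF _ _ r(1)])
    show "(\<lambda>w. u w - u z) holomorphic_on ball z r"
      using hol' sub by (meson ball_subset_cball holomorphic_on_subset subset_trans)
    show "continuous_on (cball z r) (\<lambda>w. u w - u z)"
      using hol' sub by (meson holomorphic_on_imp_continuous_on holomorphic_on_subset)
    fix w assume w: "cmod (z - w) = r"
    then have "w \<in> ball 0 R" using sub by (auto simp: dist_norm)
    then show "cmod (u w - u z) \<le> K * r" using lip[OF _ zb, of w] w by (simp add: norm_minus_commute)
  qed
  moreover have "(deriv ^^ n) (\<lambda>w. u w - u z) z = (deriv ^^ n) u z"
    using higher_deriv_diff[OF hol holomorphic_on_const, of z n "u z"] zb n by simp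
  ultimately show ?thesis by simp
qed

text \<open>On the unit disc, circles of radius \<open>R / 2\<close> stay inside the domain and bound the second
  derivative by \<open>4 * K / R\<close>.\<close>

lemma lipschitz_Taylor_remainder:
  fixes u :: "complex \<Rightarrow> complex"
  assumes hol: "u holomorphic_on ball 0 R" and R: "R > 2"
    and lip: "\<And>z w. z \<in> ball 0 R \<Longrightarrow> w \<in> ball 0 R \<Longrightarrow> cmod (u z - u w) \<le> K * cmod (z - w)"
  shows "cmod (u 1 - u 0 - deriv u 0) \<le> 4 * K / R"
proof -
  have "cmod ((deriv ^^ 0) u 1 - (\<Sum>i\<le>1. (deriv ^^ i) u 0 * (1 - 0) ^ i / fact i))
      \<le> 4 * K / R * cmod (1 - 0) ^ (Suc 1) / fact 1"
  proof (rule complex_Taylor[where S = "cball 0 1"])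
    fix i and z :: complex assume z: "z \<in> cball 0 1"
    then have zb: "z \<in> ball 0 R" using R by auto
    show "((deriv ^^ i) u has_field_derivative (deriv ^^ Suc i) u z) (at z within cball 0 1)"
      using has_field_derivative_at_within[OF holomorphic_derivI[OF holomorphic_higher_deriv[OF hol] _ zb]]
      by simp
    have "cmod ((deriv ^^ 2) u z) \<le> fact 2 * (K * (R / 2)) / (R / 2) ^ 2"
      by (rule lipschitz_Cauchy_inequality[OF hol lip]) (use z R in auto)
    also have "\<dots> = 4 * K / R" using R by (simp add: power2_eq_square field_simps)
    finally show "cmod ((deriv ^^ Suc 1) u z) \<le> 4 * K / R" by (simp add: numeral_2_eq_2)
  qed auto
  then show ?thesis by (simp add: algebra_simps)
qed

text \<open>The one-variable estimates are applied to \<open>u \<zeta> = g (a + \<zeta> h)\<close>, which is holomorphic on the disc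
  of radius \<open>R = (1 - norm a) / norm h\<close> with Lipschitz constant \<open>norm g * norm h\<close> and derivative
  \<open>D h\<close> at \<open>0\<close>.\<close>

context
  fixes g :: "('a::complex_normed_vector, complex) hlip0" and a h :: 'a and D :: "'a cdual"
  assumes a: "a \<in> ball 0 1" and D: "(hlip0_apply g has_derivative cblinfun_apply D) (at a)"
    and h: "h \<noteq> 0"
begin

private abbreviation "u \<equiv> \<lambda>\<zeta>. hlip0_apply g (a + \<zeta> *\<^sub>C h)"
private abbreviation "R \<equiv> (1 - norm a) / norm h"

private lemma line_in_ball: "\<zeta> \<in> ball 0 R \<Longrightarrow> a + \<zeta> *\<^sub>C h \<in> ball 0 1"
  using norm_triangle_ineq[of a "\<zeta> *\<^sub>C h"] h by (simp add: norm_scaleC field_simps)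

private lemma u_holomorphic: "u holomorphic_on ball 0 R"
proof (rule holomorphic_onI)
  fix \<zeta> :: complex assume "\<zeta> \<in> ball 0 R"
  then obtain E :: "'a cdual" where "(hlip0_apply g has_derivative cblinfun_apply E) (at (a + \<zeta> *\<^sub>C h))"
    using hlip0_derivative[OF line_in_ball, of \<zeta> g] by blast
  from has_field_derivative_at_within[OF has_field_derivative_along_line[OF this]]
  show "u field_differentiable at \<zeta> within ball 0 R" unfolding field_differentiable_def by blast
qed

private lemma u_lipschitz:
  assumes "z \<in> ball 0 R" "w \<in> ball 0 R"
  shows "cmod (u z - u w) \<le> (norm g * norm h) * cmod (z - w)"
proof -
  have "a + z *\<^sub>C h - (a + w *\<^sub>C h) = (z - w) *\<^sub>C h"
    by (simp add: complex_vector.scale_left_diff_distrib)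
  then show ?thesis
    using hlip0_lipschitz[OF assms[THEN line_in_ball], of g] by (simp add: norm_scaleC mult_ac)
qed

private lemma deriv_u: "deriv u 0 = cblinfun_apply D h"
  by (rule DERIV_imp_deriv[OF has_field_derivative_along_line]) (use D in simp)

lemma hlip0_derivative_bound_nz: "cmod (cblinfun_apply D h) \<le> norm g * norm h"
proof -
  obtain r where r: "0 < r" "r < R" using a h dense[of 0 R] by auto
  have "cmod ((deriv ^^ 1) u 0) \<le> fact 1 * ((norm g * norm h) * r) / r ^ 1"
    by (rule lipschitz_Cauchy_inequality[OF u_holomorphic u_lipschitz]) (use r in auto)
  then show ?thesis using r(1) by (simp add: deriv_u)
qed

lemma hlip0_remainder_nz:
  assumes "norm h < (1 - norm a) / 2"
  shows "cmod (hlip0_apply g (a + h) - hlip0_apply g a - cblinfun_apply D h)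
    \<le> 4 * norm g * (norm h)\<^sup>2 / (1 - norm a)"
proof -
  have "R > 2" using assms h by (simp add: field_simps)
  have "cmod (u 1 - u 0 - deriv u 0) \<le> 4 * (norm g * norm h) / R"
    by (rule lipschitz_Taylor_remainder[OF u_holomorphic \<open>R > 2\<close> u_lipschitz])
  then show ?thesis unfolding deriv_u by (simp add: scaleC_one power2_eq_square mult.assoc)
qed

end

lemma hlip0_derivative_bound:
  fixes g :: "('a::complex_normed_vector, complex) hlip0" and D :: "'a cdual"
  assumes "a \<in> ball 0 1" "(hlip0_apply g has_derivative cblinfun_apply D) (at a)"
  shows "cmod (cblinfun_apply D h) \<le> norm g * norm h"
  using hlip0_derivative_bound_nz[OF assms] by (cases "h = 0") (auto simp: cblinfun_0)

lemma hlip0_remainder: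
  fixes g :: "('a::complex_normed_vector, complex) hlip0" and D :: "'a cdual"
  assumes "a \<in> ball 0 1" "(hlip0_apply g has_derivative cblinfun_apply D) (at a)"
    and "norm h < (1 - norm a) / 2"
  shows "cmod (hlip0_apply g (a + h) - hlip0_apply g a - cblinfun_apply D h)
    \<le> 4 * norm g * (norm h)\<^sup>2 / (1 - norm a)"
  using hlip0_remainder_nz[OF assms(1,2) _ assms(3)] by (cases "h = 0") (auto simp: cblinfun_0)

section \<open>The universal holomorphic Lipschitz map\<close>

lemma has_derivative_quadratic:
  fixes f :: "'a::real_normed_vector \<Rightarrow> 'b::real_normed_vector"
  assumes D: "bounded_linear D" and r: "r > 0"
    and q: "\<And>h. norm h < r \<Longrightarrow> norm (f (a + h) - f a - D h) \<le> C * (norm h)\<^sup>2"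
  shows "(f has_derivative D) (at a)"
  unfolding has_derivative_at
proof (intro conjI D)
  show "(\<lambda>h. norm (f (a + h) - f a - D h) / norm h) \<midarrow>0\<rightarrow> 0"
  proof (rule Lim_null_comparison)
    show "\<forall>\<^sub>F h in at 0. norm (norm (f (a + h) - f a - D h) / norm h) \<le> C * norm h"
      unfolding eventually_at
    proof (intro exI[of _ r] conjI r ballI impI)
      fix h :: 'a assume "h \<noteq> 0 \<and> dist h 0 < r"
      then show "norm (norm (f (a + h) - f a - D h) / norm h) \<le> C * norm h"
        using q[of h] by (simp add: divide_le_eq power2_eq_square mult.assoc)
    qed
    show "(\<lambda>h :: 'a. C * norm h) \<midarrow>0\<rightarrow> 0"
      by (rule tendsto_eq_intros | simp)+
  qed
qed

definition eval_at :: "'a::complex_normed_vector \<Rightarrow> ('a, complex) hlip0 cdual"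
  where "eval_at x = CBlinfun (\<lambda>g. hlip0_apply g x)"

lemma eval_at_apply: "cblinfun_apply (eval_at x) g = hlip0_apply g x"
  unfolding eval_at_def
  by (subst cblinfun_apply_CBlinfun[OF _ norm_hlip0_apply_le]) (simp_all add: clinear_on_def hlip0_ops)

definition hlip0_deriv :: "'a::complex_normed_vector \<Rightarrow> ('a, complex) hlip0 \<Rightarrow> 'a cdual"
  where "hlip0_deriv a g = (SOME D. (hlip0_apply g has_derivative cblinfun_apply D) (at a))"

context
  fixes a :: "'a::complex_normed_vector"
  assumes a: "a \<in> ball 0 1"
begin

lemma hlip0_deriv: "(hlip0_apply g has_derivative cblinfun_apply (hlip0_deriv a g)) (at a)"
  unfolding hlip0_deriv_def by (rule someI_ex[OF hlip0_derivative[OF a]])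

lemma hlip0_deriv_unique:
  assumes "(hlip0_apply g has_derivative cblinfun_apply D) (at a)"
  shows "hlip0_deriv a g = D"
  using has_derivative_unique[OF hlip0_deriv assms] by (simp add: cblinfun_apply_inject)

lemma hlip0_deriv_add: "hlip0_deriv a (f + g) = hlip0_deriv a f + hlip0_deriv a g"
proof (rule hlip0_deriv_unique)
  show "(hlip0_apply (f + g) has_derivative cblinfun_apply (hlip0_deriv a f + hlip0_deriv a g)) (at a)"
    unfolding plus_hlip0.rep_eq plus_cblinfun.rep_eq by (rule has_derivative_add[OF hlip0_deriv hlip0_deriv])
qed

lemma hlip0_deriv_scaleC: "hlip0_deriv a (b *\<^sub>C g) = b *\<^sub>C hlip0_deriv a g"
proof (rule hlip0_deriv_unique)
  show "(hlip0_apply (b *\<^sub>C g) has_derivative cblinfun_apply (b *\<^sub>C hlip0_deriv a g)) (at a)"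
    unfolding scaleC_hlip0.rep_eq scaleC_cblinfun.rep_eq
    by (rule bounded_linear.has_derivative[OF bounded_linear_scaleC hlip0_deriv])
qed

text \<open>Both \<open>h \<mapsto> (g \<mapsto> g'(a) h)\<close> and its values are bounded, and the second-order remainder
  bound is uniform over the unit ball of functions \<open>g\<close>, which is norm convergence in the dual.\<close>

lemma eval_at_derivative:
  "\<exists>D :: ('a, ('a, complex) hlip0 cdual) cblinfun. (eval_at has_derivative cblinfun_apply D) (at a)"
proof -
  define E :: "'a \<Rightarrow> ('a, complex) hlip0 cdual"
    where "E h = CBlinfun (\<lambda>g. cblinfun_apply (hlip0_deriv a g) h)" for h
  have E: "cblinfun_apply (E h) g = cblinfun_apply (hlip0_deriv a g) h" for h g
    unfolding E_def
  proof (subst cblinfun_apply_CBlinfun)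
    show "clinear_on UNIV (\<lambda>g. cblinfun_apply (hlip0_deriv a g) h)"
      by (simp add: clinear_on_def hlip0_deriv_add hlip0_deriv_scaleC cblinfun_ops)
    show "norm (cblinfun_apply (hlip0_deriv a g) h) \<le> norm h * norm g" for g
      using hlip0_derivative_bound[OF a hlip0_deriv] by (simp add: mult.commute)
  qed simp
  have "norm (E h) \<le> 1 * norm h" for h
  proof (rule norm_cblinfun_leI)
    show "norm (cblinfun_apply (E h) g) \<le> 1 * norm h * norm g" for g
      unfolding E using hlip0_derivative_bound[OF a hlip0_deriv] by (simp add: mult.commute)
  qed simp
  moreover have "clinear_on UNIV E"
    unfolding clinear_on_def by (auto intro!: cblinfun_eqI simp: E cblinfun_ops cblinfun_simps)
  ultimately have ap: "cblinfun_apply (CBlinfun E) = E" by (intro cblinfun_apply_CBlinfun)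
  have "(eval_at has_derivative cblinfun_apply (CBlinfun E)) (at a)"
  proof (rule has_derivative_quadratic[OF cblinfun_bounded_linear])
    show "(1 - norm a) / 2 > 0" using a by simp
    fix h :: 'a assume h: "norm h < (1 - norm a) / 2"
    show "norm (eval_at (a + h) - eval_at a - cblinfun_apply (CBlinfun E) h) \<le> 4 / (1 - norm a) * (norm h)\<^sup>2"
      unfolding ap
    proof (rule norm_cblinfun_leI)
      fix g
      show "norm (cblinfun_apply (eval_at (a + h) - eval_at a - E h) g)
          \<le> 4 / (1 - norm a) * (norm h)\<^sup>2 * norm g"
        using hlip0_remainder[OF a hlip0_deriv h, of g]
        by (simp add: cblinfun_ops eval_at_apply E mult_ac)
    qed (use a in simp)
  qed
  then show ?thesis by blast
qed

end

lift_definition universal_hlip0 ::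
    "('a::complex_normed_vector, ('a, complex) hlip0 cdual) hlip0" is eval_at
proof (intro conjI allI impI)
  show "holomorphic_map_on eval_at (ball (0 :: 'a) 1)"
    unfolding holomorphic_map_on_def using eval_at_derivative by blast
  have "1-lipschitz_on (ball (0 :: 'a) 1) eval_at"
  proof (rule lipschitz_onI)
    fix x y :: 'a assume xy: "x \<in> ball 0 1" "y \<in> ball 0 1"
    have "norm (eval_at x - eval_at y) \<le> norm (x - y)"
      by (rule norm_cblinfun_leI)
        (use hlip0_lipschitz[OF xy] in \<open>simp_all add: cblinfun_ops eval_at_apply mult.commute\<close>)
    then show "dist (eval_at x) (eval_at y) \<le> 1 * dist x y" by (simp add: dist_norm)
  qed simp
  then show "\<exists>K. K-lipschitz_on (ball 0 1) (eval_at :: 'a \<Rightarrow> _)" by blast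
  show "eval_at (0 :: 'a) = 0" by (rule cblinfun_eqI) (simp add: eval_at_apply hlip0_at_0 cblinfun_ops)
  show "eval_at x = 0" if "x \<notin> ball 0 1" for x :: 'a
    by (rule cblinfun_eqI) (simp add: eval_at_apply hlip0_outside[OF that] cblinfun_ops)
qed

lift_definition compose_hlip0 ::
    "('y::complex_normed_vector, 'z::complex_normed_vector) cblinfun \<Rightarrow>
     ('x::complex_normed_vector, 'y) hlip0 \<Rightarrow> ('x, 'z) hlip0"
  is "\<lambda>S f. cblinfun_apply S \<circ> f"
proof -
  fix f :: "'x \<Rightarrow> 'y" and S :: "('y, 'z) cblinfun"
  assume f: "holomorphic_map_on f (ball 0 1) \<and> (\<exists>K. K-lipschitz_on (ball 0 1) f) \<and> f 0 = 0 \<and>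
    (\<forall>x. x \<notin> ball 0 1 \<longrightarrow> f x = 0)"
  then obtain K where K: "K-lipschitz_on (ball 0 1) f" by blast
  obtain C where C: "C-lipschitz_on (f ` ball 0 1) (cblinfun_apply S)"
    using bounded_linear.lipschitz_boundE[OF cblinfun_bounded_linear] by blast
  show "holomorphic_map_on (cblinfun_apply S \<circ> f) (ball 0 1) \<and>
    (\<exists>K. K-lipschitz_on (ball 0 1) (cblinfun_apply S \<circ> f)) \<and> (cblinfun_apply S \<circ> f) 0 = 0 \<and>
    (\<forall>x. x \<notin> ball 0 1 \<longrightarrow> (cblinfun_apply S \<circ> f) x = 0)"
    using f lipschitz_on_compose[OF K C]
    by (auto simp: holomorphic_map_on_cblinfun_compose cblinfun_0)
qed

section \<open>The transpose\<close>

lemma transpose_apply: "hlip0_apply (transpose_hlip0 f \<phi>) x = cblinfun_apply \<phi> (hlip0_apply f x)"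
  by (simp add: transpose_hlip0.rep_eq)

lemma transpose_clinear: "clinear_on UNIV (transpose_hlip0 f)"
  unfolding clinear_on_def
  by (auto intro!: hlip0_eqI simp: transpose_apply hlip0_ops cblinfun_ops)

lemma clinear_transpose: "clinear_on V transpose_hlip0"
  unfolding clinear_on_def
  by (auto intro!: hlip0_eqI ext simp: transpose_apply hlip0_ops cblinfun_simps scaleC_fun_def)

lemma norm_transpose_le:
  fixes f :: "('x::complex_normed_vector, 'y::complex_normed_vector) hlip0"
  shows "norm (transpose_hlip0 f \<phi>) \<le> norm f * norm \<phi>"
proof (rule norm_hlip0_leI)
  fix x y :: 'x assume xy: "x \<in> ball 0 1" "y \<in> ball 0 1"
  have "norm (cblinfun_apply \<phi> (hlip0_apply f x - hlip0_apply f y)) \<le> norm \<phi> * (norm f * norm (x - y))"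
    by (rule order_trans[OF norm_cblinfun_le mult_left_mono[OF hlip0_lipschitz[OF xy] norm_ge_zero]])
  then show "norm (hlip0_apply (transpose_hlip0 f \<phi>) x - hlip0_apply (transpose_hlip0 f \<phi>) y)
      \<le> norm f * norm \<phi> * norm (x - y)"
    by (simp add: transpose_apply cblinfun_diff mult_ac)
qed simp

lemma bounded_linear_transpose: "bounded_linear (transpose_hlip0 f)"
  by (rule clinear_on_imp_bounded_linear[OF transpose_clinear norm_transpose_le])

text \<open>For the lower bound, a functional norming \<open>f x - f y\<close> turns the increment of \<open>f\<close> into one of
  \<open>\<phi> \<circ> f\<close>.\<close>

lemma onorm_transpose:
  fixes f :: "('x::complex_normed_vector, 'y::complex_normed_vector) hlip0"
  shows "onorm (transpose_hlip0 f) = norm f"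
proof (rule antisym)
  show "onorm (transpose_hlip0 f) \<le> norm f"
    by (rule onorm_bound) (simp_all add: norm_transpose_le)
  note bl = bounded_linear_transpose[of f]
  show "norm f \<le> onorm (transpose_hlip0 f)"
  proof (rule norm_hlip0_leI[OF onorm_pos_le[OF bl]])
    fix x y :: 'x assume xy: "x \<in> ball 0 1" "y \<in> ball 0 1"
    let ?d = "hlip0_apply f x - hlip0_apply f y"
    obtain \<phi> :: "'y cdual" where \<phi>: "norm \<phi> \<le> 1" "cblinfun_apply \<phi> ?d = of_real (norm ?d)"
      using norming_functional by blast
    have "norm ?d = cmod (hlip0_apply (transpose_hlip0 f \<phi>) x - hlip0_apply (transpose_hlip0 f \<phi>) y)"
      unfolding transpose_apply cblinfun_diff[symmetric] \<phi>(2) by simp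
    also have "\<dots> \<le> norm (transpose_hlip0 f \<phi>) * norm (x - y)" by (rule hlip0_lipschitz[OF xy])
    also have "norm (transpose_hlip0 f \<phi>) \<le> onorm (transpose_hlip0 f)"
      using onorm[OF bl, of \<phi>] mult_left_mono[OF \<phi>(1) onorm_pos_le[OF bl]] by simp
    finally show "norm ?d \<le> onorm (transpose_hlip0 f) * norm (x - y)" by (simp add: mult_right_mono)
  qed
qed

lemma inj_transpose:
  "inj (transpose_hlip0 :: ('x::complex_normed_vector, 'y::complex_normed_vector) hlip0 \<Rightarrow> _)"
proof (rule injI)
  fix f g :: "('x, 'y) hlip0" assume eq: "transpose_hlip0 f = transpose_hlip0 g"
  show "f = g"
  proof (rule hlip0_eqI, rule cdual_separates)
    fix x and \<phi> :: "'y cdual"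
    show "cblinfun_apply \<phi> (hlip0_apply f x) = cblinfun_apply \<phi> (hlip0_apply g x)"
      unfolding transpose_apply[symmetric] eq ..
  qed
qed

text \<open>The image \<open>S ` B\<close> of the unit ball inherits absolute convexity, and the Lipschitz norm of \<open>\<phi> \<circ> f\<close> is at
  most any bound for \<open>\<bar>\<phi>\<bar>\<close> on it. Dividing \<open>F\<close> by \<open>1 + norm F\<close> brings the pulled back functional below the
  supremum over \<open>S ` B\<close>.\<close>

lemma transpose_weakly_compact:
  fixes f :: "('x::complex_normed_vector, 'y::complex_normed_vector) hlip0"
  assumes "f \<in> weakly_compact_hlip0"
  shows "transpose_hlip0 f \<in> weak_star_weak_operators"
proof -
  obtain E :: "'y set" and n and S :: "'y \<Rightarrow> 'y" where ban: "complex_banach_on E n"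
    and S: "weakly_compact_operator_on E n S" and sub: "lip_image f \<subseteq> S ` {v \<in> E. n v \<le> 1}"
    using assms unfolding weakly_compact_hlip0_def W_bounded_set_def by blast
  define B where "B = {v \<in> E. n v \<le> 1}"
  have nE: "complex_norm_on E n" using ban by (simp add: complex_banach_on_def)
  have E: "complex_vector.subspace E" using nE by (simp add: complex_norm_on_def)
  have Sl: "S (x + y) = S x + S y" "S (a *\<^sub>C x) = a *\<^sub>C S x" if "x \<in> E" "y \<in> E" for x y a
    using S that by (auto simp: weakly_compact_operator_on_def clinear_on_def)
  have n0: "n 0 = 0" using nE E by (auto simp: complex_norm_on_def complex_vector.subspace_0)
  then have "0 \<in> B" using E by (simp add: B_def complex_vector.subspace_0)
  have ac: "abs_convex (S ` B)"
    unfolding abs_convex_def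
  proof (intro ballI allI impI)
    fix x y a b assume "x \<in> S ` B" "y \<in> S ` B" and ab: "cmod a + cmod b \<le> 1"
    then obtain v w where v: "v \<in> E" "n v \<le> 1" "x = S v" and w: "w \<in> E" "n w \<le> 1" "y = S w"
      by (auto simp: B_def)
    have mem: "a *\<^sub>C v \<in> E" "b *\<^sub>C w \<in> E" using E v(1) w(1) by (simp_all add: complex_vector.subspace_scale)
    have "n (a *\<^sub>C v + b *\<^sub>C w) \<le> n (a *\<^sub>C v) + n (b *\<^sub>C w)"
      using nE mem by (simp add: complex_norm_on_def)
    also have "\<dots> = cmod a * n v + cmod b * n w" using nE v(1) w(1) by (simp add: complex_norm_on_def)
    also have "\<dots> \<le> cmod a * 1 + cmod b * 1" using v(2) w(2) by (intro add_mono mult_left_mono) auto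
    finally have "a *\<^sub>C v + b *\<^sub>C w \<in> B"
      using ab E mem by (simp add: B_def complex_vector.subspace_add)
    moreover have "a *\<^sub>C x + b *\<^sub>C y = S (a *\<^sub>C v + b *\<^sub>C w)"
      using Sl mem v w by simp
    ultimately show "a *\<^sub>C x + b *\<^sub>C y \<in> S ` B" by blast
  qed
  have "\<exists>y. \<forall>\<phi>. cblinfun_apply F (transpose_hlip0 f \<phi>) = cblinfun_apply \<phi> y" for F :: "('x, complex) hlip0 cdual"
  proof -
    define c where "c = 1 + norm F"
    have c: "c > 0" by (simp add: c_def add_pos_nonneg)
    define g where "g \<phi> = cblinfun_apply F (transpose_hlip0 f \<phi>) / of_real c" for \<phi>
    have "\<exists>y. \<forall>\<phi>. g \<phi> = cblinfun_apply \<phi> y"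
    proof (rule dominated_functional_represented)
      show "relatively_weakly_compact (S ` B)"
        using S by (simp add: weakly_compact_operator_on_def B_def)
      show "S ` B \<noteq> {}" using \<open>0 \<in> B\<close> by blast
      show "abs_convex (S ` B)" by (rule ac)
      show "clinear_on UNIV g"
        unfolding clinear_on_def g_def
        by (simp add: clinear_on_simps[OF transpose_clinear] cblinfun_simps add_divide_distrib scaleC_complex_def)
      fix \<phi> r assume r: "\<And>d. d \<in> S ` B \<Longrightarrow> cmod (cblinfun_apply \<phi> d) \<le> r"
      have "0 \<le> r" using r[of "S 0"] \<open>0 \<in> B\<close> norm_ge_zero order_trans by blast
      have "norm (transpose_hlip0 f \<phi>) \<le> r"
      proof (rule norm_hlip0_leI[OF \<open>0 \<le> r\<close>])
        fix x y :: 'x assume xy: "x \<in> ball 0 1" "y \<in> ball 0 1"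
        show "norm (hlip0_apply (transpose_hlip0 f \<phi>) x - hlip0_apply (transpose_hlip0 f \<phi>) y) \<le> r * norm (x - y)"
        proof (cases "x = y")
          case False
          let ?d = "hlip0_apply f x - hlip0_apply f y"
          have "?d /\<^sub>R norm (x - y) \<in> lip_image f" unfolding lip_image_def using xy False by blast
          then have "cmod (cblinfun_apply \<phi> (?d /\<^sub>R norm (x - y))) \<le> r" using sub by (intro r) (auto simp: B_def)
          then have "cmod (cblinfun_apply \<phi> ?d) \<le> r * norm (x - y)"
            using False unfolding cblinfun_scaleR by (simp add: divide_simps mult.commute)
          then show ?thesis by (simp add: transpose_apply cblinfun_diff)
        qed simp
      qed
      then have "cmod (cblinfun_apply F (transpose_hlip0 f \<phi>)) \<le> norm F * r"
        using order_trans[OF norm_cblinfun_le mult_left_mono[OF _ norm_ge_zero]] by blast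
      also have "\<dots> \<le> c * r" using \<open>0 \<le> r\<close> by (intro mult_right_mono) (simp_all add: c_def)
      finally show "cmod (g \<phi>) \<le> r" using c by (simp add: g_def norm_divide field_simps)
    qed
    then obtain y where y: "\<And>\<phi>. g \<phi> = cblinfun_apply \<phi> y" by blast
    have "cblinfun_apply F (transpose_hlip0 f \<phi>) = cblinfun_apply \<phi> (of_real c *\<^sub>C y)" for \<phi>
      using y[of \<phi>] c by (simp add: g_def cblinfun_scaleC scaleC_complex_def field_simps)
    then show ?thesis by blast
  qed
  then show ?thesis unfolding weak_star_weak_operators_iff using transpose_clinear by blast
qed

text \<open>The map \<open>S\<close>, of which \<open>T\<close> is the adjoint, plays two roles: composed with the evaluation map
  it yields \<open>f\<close>, and it is the weakly compact operator whose image of the unit ball contains the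
  Lipschitz image of \<open>f\<close>.\<close>

lemma weak_star_weak_operator_is_transpose:
  fixes T :: "'y::complex_normed_vector cdual \<Rightarrow> ('x::complex_normed_vector, complex) hlip0"
  assumes "T \<in> weak_star_weak_operators"
  shows "\<exists>f\<in>weakly_compact_hlip0. transpose_hlip0 f = T"
proof -
  have T: "clinear_on UNIV T"
    and "\<forall>F :: ('x, complex) hlip0 cdual. \<exists>y. \<forall>\<phi>. cblinfun_apply F (T \<phi>) = cblinfun_apply \<phi> y"
    using assms by (simp_all add: weak_star_weak_operators_iff)
  then obtain S :: "('x, complex) hlip0 cdual \<Rightarrow> 'y"
    where "\<forall>F \<phi>. cblinfun_apply F (T \<phi>) = cblinfun_apply \<phi> (S F)" by metis
  then have S: "cblinfun_apply \<phi> (S F) = cblinfun_apply F (T \<phi>)" for F \<phi> by simp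
  have lin: "clinear_on UNIV S"
    unfolding clinear_on_def
  proof (intro conjI ballI allI)
    show "S (F + G) = S F + S G" for F G
      by (rule cdual_separates) (simp add: S cblinfun_add plus_cblinfun.rep_eq)
    show "S (a *\<^sub>C F) = a *\<^sub>C S F" for a F
      by (rule cdual_separates) (simp add: S cblinfun_scaleC scaleC_cblinfun.rep_eq)
  qed
  have "\<exists>b. \<forall>y\<in>S ` cball 0 1. norm y \<le> b"
  proof (rule weakly_bounded_imp_bounded)
    fix \<phi> :: "'y cdual"
    have "cmod (cblinfun_apply \<phi> (S F)) \<le> norm (T \<phi>)" if "F \<in> cball 0 1" for F
      unfolding S using norm_cblinfun_le[of F "T \<phi>"] mult_right_mono[of "norm F" 1 "norm (T \<phi>)"] that by simp
    then show "\<exists>b. \<forall>m\<in>S ` cball 0 1. cmod (cblinfun_apply \<phi> m) \<le> b" by blast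
  qed
  then obtain b where b: "\<And>F. F \<in> cball 0 1 \<Longrightarrow> norm (S F) \<le> b" by blast
  have bd: "norm (S F) \<le> b * norm F" for F
  proof (cases "F = 0")
    case False
    have "norm (S (inverse (norm F) *\<^sub>R F)) \<le> b" by (rule b) (use False in simp)
    then have "\<bar>inverse (norm F)\<bar> * norm (S F) \<le> b"
      unfolding scaleR_scaleC clinear_on_simps[OF lin] norm_scaleC norm_of_real .
    then show ?thesis using False by (simp add: field_simps)
  qed (simp add: clinear_on_simps[OF lin])
  note ap = cblinfun_apply_CBlinfun[OF lin bd]
  define f where "f = compose_hlip0 (CBlinfun S) universal_hlip0"
  have f: "hlip0_apply f x = S (eval_at x)" for x
    by (simp add: f_def compose_hlip0.rep_eq universal_hlip0.rep_eq ap)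
  have "transpose_hlip0 f \<phi> = T \<phi>" for \<phi>
    by (rule hlip0_eqI) (simp add: transpose_apply f S eval_at_apply)
  then have "transpose_hlip0 f = T" by blast
  moreover have "W_bounded_set (lip_image f)"
  proof (rule W_bounded_set_image_cball[OF clinear_on_imp_bounded_linear[OF lin bd] lin])
    have "compactin weak_topology (S ` cball 0 1)" by (rule weakly_compact_image_dual_ball[OF S])
    then show "relatively_weakly_compact (S ` cball 0 1)"
      unfolding relatively_weakly_compact_def
      using compactin_imp_closedin[OF Hausdorff_weak_topology] closure_of_closedin by metis
    show "lip_image f \<subseteq> S ` cball 0 1"
    proof
      fix m assume "m \<in> lip_image f"
      then obtain x y where xy: "x \<in> ball 0 1" "y \<in> ball 0 1" "x \<noteq> y"
        and m: "m = (hlip0_apply f x - hlip0_apply f y) /\<^sub>R norm (x - y)"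
        unfolding lip_image_def by blast
      let ?F = "(eval_at x - eval_at y) /\<^sub>R norm (x - y)"
      have "norm (eval_at x - eval_at y) \<le> norm (x - y)"
        by (rule norm_cblinfun_leI)
          (use hlip0_lipschitz[OF xy(1,2)] in \<open>simp_all add: cblinfun_ops eval_at_apply mult.commute\<close>)
      then have "?F \<in> cball 0 1" using xy(3)
        unfolding mem_cball_0 norm_scaleR by (simp add: divide_simps)
      moreover have "m = S ?F"
        unfolding m f by (simp add: scaleR_scaleC clinear_on_simps[OF lin])
      ultimately show "m \<in> S ` cball 0 1" by blast
    qed
  qed
  ultimately show ?thesis unfolding weakly_compact_hlip0_def by blast
qed

lemma image_transpose:
  "transpose_hlip0 ` weakly_compact_hlip0 =
    (weak_star_weak_operators :: ('y::complex_normed_vector cdual \<Rightarrow> ('x::complex_normed_vector, complex) hlip0) set)"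
  using transpose_weakly_compact weak_star_weak_operator_is_transpose by (force simp: image_iff)

lemma subspace_weak_star_weak_operators:
  "complex_vector.subspace
    (weak_star_weak_operators :: ('y::complex_normed_vector cdual \<Rightarrow> 'z::complex_normed_vector) set)"
  unfolding complex_vector.subspace_def
proof (intro conjI ballI allI)
  show "0 \<in> (weak_star_weak_operators :: ('y cdual \<Rightarrow> 'z) set)"
    unfolding weak_star_weak_operators_iff
    by (auto simp: clinear_on_def cblinfun_0 intro!: exI[of _ 0])
next
  fix T U :: "'y cdual \<Rightarrow> 'z" assume T: "T \<in> weak_star_weak_operators" and U: "U \<in> weak_star_weak_operators"
  have "\<exists>y. \<forall>\<phi>. cblinfun_apply F ((T + U) \<phi>) = cblinfun_apply \<phi> y" for F :: "'z cdual"
  proof -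
    obtain y z where "\<And>\<phi>. cblinfun_apply F (T \<phi>) = cblinfun_apply \<phi> y" "\<And>\<phi>. cblinfun_apply F (U \<phi>) = cblinfun_apply \<phi> z"
      using T U unfolding weak_star_weak_operators_iff by metis
    then show ?thesis by (intro exI[of _ "y + z"]) (simp add: cblinfun_add)
  qed
  moreover have "clinear_on UNIV (T + U)"
    using T U by (simp add: weak_star_weak_operators_iff clinear_on_def scaleC_add_right)
  ultimately show "T + U \<in> weak_star_weak_operators" by (simp add: weak_star_weak_operators_iff)
next
  fix a and T :: "'y cdual \<Rightarrow> 'z" assume T: "T \<in> weak_star_weak_operators"
  have "\<exists>y. \<forall>\<phi>. cblinfun_apply F ((a *\<^sub>C T) \<phi>) = cblinfun_apply \<phi> y" for F :: "'z cdual"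
  proof -
    obtain y where "\<And>\<phi>. cblinfun_apply F (T \<phi>) = cblinfun_apply \<phi> y"
      using T unfolding weak_star_weak_operators_iff by metis
    then show ?thesis by (intro exI[of _ "a *\<^sub>C y"]) (simp add: cblinfun_scaleC scaleC_fun_def)
  qed
  moreover have "clinear_on UNIV (a *\<^sub>C T)"
    using T by (simp add: weak_star_weak_operators_iff clinear_on_def scaleC_fun_def scaleC_add_right scaleC_scaleC mult.commute)
  ultimately show "a *\<^sub>C T \<in> weak_star_weak_operators" by (simp add: weak_star_weak_operators_iff)
qed

lemma transpose_mem_iff: "transpose_hlip0 f \<in> weak_star_weak_operators \<longleftrightarrow> f \<in> weakly_compact_hlip0"
  using image_transpose inj_transpose by (metis inj_image_mem_iff)

theorem proposition3p6:
  shows "isometric_isomorphism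
    (weakly_compact_hlip0 :: ('x::complex_banach, 'y::complex_banach) hlip0 set) norm
    (weak_star_weak_operators :: ('y cdual \<Rightarrow> ('x, complex) hlip0) set) onorm
    transpose_hlip0"
proof -
  let ?V = "weakly_compact_hlip0 :: ('x, 'y) hlip0 set"
  let ?W = "weak_star_weak_operators :: ('y cdual \<Rightarrow> ('x, complex) hlip0) set"
  note W = subspace_weak_star_weak_operators[where 'y = 'y and 'z = "('x, complex) hlip0"]
  have bl: "bounded_linear T" if "T \<in> ?W" for T
    using that bounded_linear_transpose unfolding image_transpose[symmetric] by blast
  have "complex_vector.subspace ?V"
    unfolding complex_vector.subspace_def Ball_def transpose_mem_iff[symmetric]
    using W clinear_on_simps[OF clinear_transpose[of "UNIV :: ('x, 'y) hlip0 set"]]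
    by (simp add: complex_vector.subspace_0 complex_vector.subspace_add complex_vector.subspace_scale)
  then have "complex_norm_on ?V norm"
    unfolding complex_norm_on_def by (simp add: norm_scaleC norm_triangle_ineq)
  moreover have "complex_norm_on ?W onorm"
    unfolding complex_norm_on_def
  proof (intro conjI ballI allI)
    show "onorm T = 0 \<longleftrightarrow> T = 0" if "T \<in> ?W" for T
      by (simp add: onorm_eq_0[OF bl[OF that]] fun_eq_iff)
    show "onorm (a *\<^sub>C T) = cmod a * onorm T" if "T \<in> ?W" for a T
      using onorm_scaleC[OF bl[OF that]] by (simp add: scaleC_fun_def)
    show "onorm (T + U) \<le> onorm T + onorm U" if "T \<in> ?W" "U \<in> ?W" for T U
      using onorm_triangle[OF bl[OF that(1)] bl[OF that(2)]] by (simp add: plus_fun_def)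
  qed (use W bl onorm_pos_le in auto)
  moreover have "bij_betw transpose_hlip0 ?V ?W"
    unfolding bij_betw_def using image_transpose inj_transpose by (metis inj_on_subset subset_UNIV)
  ultimately show ?thesis
    unfolding isometric_isomorphism_def using clinear_transpose onorm_transpose by blast
qed

end
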